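(* Let $G$ be a second countable compact abelian group and let $A:G\to G$ be a continuous surjective group homomorphism such that $\ker A$ is finite and $\bigcup_{j\in\mathbb{N}_0}\ker A^j$ is dense in $G$; put $m=|\ker A|$. Suppose $(V_j)_{j\in\mathbb{N}_0}$ is an MRA of $L^2(G)$ and $(\varphi_j)_{j\in\mathbb{N}_0}$ is an orthonormal scaling sequence of it with $\varphi_0\equiv 1$. Let $\psi^\nu_j$ ($j\in\mathbb{N}_0$, $\nu=1,\ldots,m-1$) be wavelet functions obtained from $(\varphi_j)$ by the construction described in the context. Then the wavelet system $$\{T_a\psi^\nu_j: a\in\ker A^j,\ j\in\mathbb{N}_0,\ \nu=1,\ldots,m-1\},$$ together with the constant function $\varphi_0\equiv 1$, forms an orthonormal basis of $L^2(G)$.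
   Context: $\mathbb{N}_0=\{0,1,2,\ldots\}$, and $A^0$ is the identity map. $\widehat{G}$ is the (discrete) dual group of continuous characters of $G$, written additively, $(\chi_1+\chi_2)(x)=\chi_1(x)\chi_2(x)$, with identity $\mathbf{0}$. For a subgroup $H\subset G$, $H^{\perp}=\{\chi\in\widehat{G}:\chi(h)=1\text{ for all }h\in H\}$. $dx$ is Haar measure on $G$ normalized to total mass $1$, functions are complex-valued, and $\widehat{f}(\chi)=\int_G f(x)\overline{\chi(x)}\,dx$. The adjoint homomorphism is $\widehat{A}(\chi)=\chi\circ A$; one has $(\ker A^j)^\perp=\widehat{A}^j(\widehat{G})$. $T_yf(x)=f(x-y)$, $y\in G$. Periodization: $Pf(x)=\sum_{a\in\ker A}f(y+a)$, where $y\in G$ is any element with $Ay=x$. An MRA of $L^2(G)$ is a sequence $(V_j)_{j\in\mathbb{N}_0}$ of closed subspaces of $L^2(G)$ such that: MR1. $V_j\subset V_{j+1}$ for all $j\in\mathbb{N}_0$; MR2. $\overline{\bigcup_{j=0}^\infty V_j}=L^2(G)$; MR3. for all $j\in\mathbb{N}_0$ and $\gamma\in\ker A^j$, $f\in V_j$ if and only if $T_\gamma f\in V_j$; MR4. for each $j\in\mathbb{N}_0$ there exists $\varphi_j\in V_j$ such that $(T_a\varphi_j)_{a\in\ker A^j}$ is a basis of $V_j$; MR5. for all $j\in\mathbb{N}_0$: a) $f\in V_j\Rightarrow f(A(\cdot))\in V_{j+1}$, and b) $f\in V_{j+1}\Rightarrow Pf\in V_j$. A sequence $(\varphi_j)$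 as in MR4 is a scaling sequence of the MRA; it is called orthonormal if $(T_a\varphi_j)_{a\in\ker A^j}$ is an orthonormal system for every $j\in\mathbb{N}_0$. Digits: $D(A)=\{\pi_0,\pi_1,\ldots,\pi_{m-1}\}\subset\widehat{G}$, with $\pi_0=\mathbf{0}$, contains exactly one representative of each coset of $\widehat{G}/(\ker A)^\perp$; $D(A^0)=\{\mathbf{0}\}$, $D(A^{j+1})=\{\widehat{A}^j\pi+r: r\in D(A^j),\ \pi\in D(A)\}$, a set of representatives of the cosets of $\widehat{G}/(\ker A^{j+1})^\perp$. Construction of the wavelet functions. For a scaling sequence $(\varphi_j)$, for every $j\in\mathbb{N}_0$ and $\eta\in\widehat{G}$ there is a unique number $\mu^{j+1}_\eta$ such that $\widehat{\varphi}_j(\chi)=\mu^{j+1}_\eta\widehat{\varphi}_{j+1}(\chi)$ for all $\chi\in(\ker A^{j+1})^\perp+\eta$. When the scaling sequence is orthonormal, $\sum_{k=0}^{m-1}|\mu^{j+1}_{\eta+\widehat{A}^j\pi_k}|^2=m$. For each $j\in\mathbb{N}_0$ and $\eta\in D(A^j)$ set $b_{0,k}=\mu^{j+1}_{\eta+\widehat{A}^j\pi_k}/\sqrt{m}$, $k=0,\ldots,m-1$, and extend this unit row to an $m\times m$ unitary matrix $B=(b_{\nu,k})_{\nu,k=0}^{m-1}$ (depending on $j$ and $\eta$, and chosen arbitrarily otherwise). Set $\alpha^{\nu,j}_{\eta+\widehat{A}^j\pi_k}=\sqrt{m}\,b_{\nu,k}$ for $\nu=1,\ldots,m-1$, $\eta\in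 D(A^j)$, $k=0,\ldots,m-1$; this defines $\alpha^{\nu,j}_\chi$ for all $\chi\in D(A^{j+1})$, and it is extended to $\widehat{G}$ by $\alpha^{\nu,j}_\chi=\alpha^{\nu,j}_\eta$ for $\chi\in(\ker A^{j+1})^\perp+\eta$, $\eta\in D(A^{j+1})$. Then $\psi^\nu_j$ is defined by $\widehat{\psi}^\nu_j(\chi)=\alpha^{\nu,j}_\chi\,\widehat{\varphi}_{j+1}(\chi)$ for $\chi\in\widehat{G}$. *)

theory Defs
  imports "HOL-Probability.Probability"
begin

section \<open>Characters\<close>

typedef (overloaded) 'a dual_group =
  "{\<xi> :: 'a::topological_ab_group_add \<Rightarrow> complex.
      continuous_on UNIV \<xi> \<and> (\<forall>x. cmod (\<xi> x) = 1) \<and> (\<forall>x y. \<xi> (x + y) = \<xi> x * \<xi> y)}"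
  morphisms chr Abs_dual_group
  by (rule exI[of _ "\<lambda>_. 1"]) simp

setup_lifting type_definition_dual_group

text \<open>The group of characters is written additively, although the operation on values is
  multiplication.\<close>

instantiation dual_group :: (topological_ab_group_add) ab_group_add
begin

lift_definition zero_dual_group :: "'a dual_group" is "\<lambda>_. 1"
  by simp

lift_definition plus_dual_group :: "'a dual_group \<Rightarrow> 'a dual_group \<Rightarrow> 'a dual_group"
  is "\<lambda>\<xi> \<eta> x. \<xi> x * \<eta> x"
  by (auto intro!: continuous_intros simp: norm_mult)

lift_definition uminus_dual_group :: "'a dual_group \<Rightarrow> 'a dual_group"
  is "\<lambda>\<xi> x. cnj (\<xi> x)"
  by (auto intro!: continuous_intros)

definition minus_dual_group :: "'a dual_group \<Rightarrow> 'a dual_group \<Rightarrow> 'a dual_group"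
  where "minus_dual_group \<xi> \<eta> = \<xi> + - \<eta>"

instance
proof
  fix a b c :: "'a dual_group"
  show "a + b + c = a + (b + c)" by transfer (simp add: mult.assoc)
  show "a + b = b + a" by transfer (simp add: mult.commute)
  show "0 + a = a" by transfer simp
  show "- a + a = 0"
    by transfer (simp add: fun_eq_iff mult.commute[of "cnj _"] complex_norm_square[symmetric])
  show "a - b = a + - b" by (fact minus_dual_group_def)
qed

end

definition annihilator :: "'a::topological_ab_group_add set \<Rightarrow> 'a dual_group set"
  where "annihilator H = {\<xi>. \<forall>h\<in>H. chr \<xi> h = 1}"

text \<open>The composite below is a character only if \<open>A\<close> is a continuous homomorphism; otherwise
  the value is unspecified.\<close>

definition adjoint_hom ::
  "('a::topological_ab_group_add \<Rightarrow> 'a) \<Rightarrow> 'a dual_group \<Rightarrow> 'a dual_group"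
  where "adjoint_hom A \<xi> = Abs_dual_group (chr \<xi> \<circ> A)"

definition ker :: "('a::zero \<Rightarrow> 'a) \<Rightarrow> 'a set"
  where "ker A = {x. A x = 0}"


section \<open>Haar measure and square integrable functions\<close>

locale normalized_haar = prob_space M
  for M :: "'a::topological_ab_group_add measure" +
  assumes sets_eq_borel: "sets M = sets borel"
    and translation_invariant: "distr M borel ((+) a) = M"

text \<open>Elements of \<open>L\<^sup>2\<close> are represented by functions rather than by classes of functions
  modulo equality almost everywhere; equations between elements are accordingly understood
  almost everywhere.\<close>

definition L2 :: "'a measure \<Rightarrow> ('a \<Rightarrow> complex) set"
  where "L2 M = {f \<in> borel_measurable M. integrable M (\<lambda>x. (cmod (f x))\<^sup>2)}"

definition l2_inner :: "'a measure \<Rightarrow> ('a \<Rightarrow> complex) \<Rightarrow> ('a \<Rightarrow> complex) \<Rightarrow> complex"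
  where "l2_inner M f g = (LINT x|M. f x * cnj (g x))"

definition l2_norm :: "'a measure \<Rightarrow> ('a \<Rightarrow> complex) \<Rightarrow> real"
  where "l2_norm M f = sqrt (LINT x|M. (cmod (f x))\<^sup>2)"

text \<open>The closure with respect to the seminorm contains, with a function, every measurable
  function equal to it almost everywhere. Hence closed subspaces in the sense below are exactly
  the preimages of closed subspaces of the space of classes.\<close>

definition l2_closure :: "'a measure \<Rightarrow> ('a \<Rightarrow> complex) set \<Rightarrow> ('a \<Rightarrow> complex) set"
  where "l2_closure M S = {f \<in> L2 M. \<forall>\<epsilon>>0. \<exists>g\<in>S. l2_norm M (\<lambda>x. f x - g x) < \<epsilon>}"

definition closed_l2_subspace :: "'a measure \<Rightarrow> ('a \<Rightarrow> complex) set \<Rightarrow> bool"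
  where "closed_l2_subspace M V \<longleftrightarrow>
    V \<subseteq> L2 M \<and> (\<lambda>_. 0) \<in> V \<and>
    (\<forall>f\<in>V. \<forall>g\<in>V. (\<lambda>x. f x + g x) \<in> V) \<and>
    (\<forall>c. \<forall>f\<in>V. (\<lambda>x. c * f x) \<in> V) \<and>
    l2_closure M V = V"

definition fin_span :: "'i set \<Rightarrow> ('i \<Rightarrow> 'a \<Rightarrow> complex) \<Rightarrow> ('a \<Rightarrow> complex) set"
  where "fin_span I e = {(\<lambda>x. \<Sum>i\<in>J. c i * e i x) | J c. finite J \<and> J \<subseteq> I}"

definition orthonormal_family :: "'a measure \<Rightarrow> 'i set \<Rightarrow> ('i \<Rightarrow> 'a \<Rightarrow> complex) \<Rightarrow> bool"
  where "orthonormal_family M I e \<longleftrightarrow>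
    (\<forall>i\<in>I. e i \<in> L2 M) \<and>
    (\<forall>i\<in>I. \<forall>k\<in>I. l2_inner M (e i) (e k) = (if i = k then 1 else 0))"

definition orthonormal_basis :: "'a measure \<Rightarrow> 'i set \<Rightarrow> ('i \<Rightarrow> 'a \<Rightarrow> complex) \<Rightarrow> bool"
  where "orthonormal_basis M I e \<longleftrightarrow>
    orthonormal_family M I e \<and> l2_closure M (fin_span I e) = L2 M"

definition finite_basis ::
  "'a measure \<Rightarrow> 'i set \<Rightarrow> ('i \<Rightarrow> 'a \<Rightarrow> complex) \<Rightarrow> ('a \<Rightarrow> complex) set \<Rightarrow> bool"
  where "finite_basis M I e V \<longleftrightarrow>
    finite I \<and> (\<forall>i\<in>I. e i \<in> V) \<and>
    (\<forall>f\<in>V. \<exists>c. AE x in M. f x = (\<Sum>i\<in>I. c i * e i x)) \<and>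
    (\<forall>c. (AE x in M. (\<Sum>i\<in>I. c i * e i x) = 0) \<longrightarrow> (\<forall>i\<in>I. c i = 0))"

definition fourier ::
  "'a::topological_ab_group_add measure \<Rightarrow> ('a \<Rightarrow> complex) \<Rightarrow> 'a dual_group \<Rightarrow> complex"
  where "fourier M f \<xi> = (LINT x|M. f x * cnj (chr \<xi> x))"

definition translate :: "'a::ab_group_add \<Rightarrow> ('a \<Rightarrow> complex) \<Rightarrow> 'a \<Rightarrow> complex"
  where "translate y f = (\<lambda>x. f (x - y))"

definition periodization ::
  "('a::ab_group_add \<Rightarrow> 'a) \<Rightarrow> ('a \<Rightarrow> complex) \<Rightarrow> 'a \<Rightarrow> complex"
  where "periodization A f = (\<lambda>x. \<Sum>a\<in>ker A. f ((SOME y. A y = x) + a))"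


section \<open>Multiresolution analyses\<close>

text \<open>\<open>ker A\<close> is finite for the maps \<open>A\<close> considered, hence so are the sets
  \<open>ker (A ^^ j)\<close>, and the spaces of an MRA are finite-dimensional.\<close>

definition scaling_sequence ::
  "'a::topological_ab_group_add measure \<Rightarrow> ('a \<Rightarrow> 'a) \<Rightarrow> (nat \<Rightarrow> ('a \<Rightarrow> complex) set)
    \<Rightarrow> (nat \<Rightarrow> 'a \<Rightarrow> complex) \<Rightarrow> bool"
  where "scaling_sequence M A V \<phi> \<longleftrightarrow>
    (\<forall>j. \<phi> j \<in> V j \<and> finite_basis M (ker (A ^^ j)) (\<lambda>a. translate a (\<phi> j)) (V j))"

definition orthonormal_scaling_sequence ::
  "'a::topological_ab_group_add measure \<Rightarrow> ('a \<Rightarrow> 'a) \<Rightarrow> (nat \<Rightarrow> ('a \<Rightarrow> complex) set)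
    \<Rightarrow> (nat \<Rightarrow> 'a \<Rightarrow> complex) \<Rightarrow> bool"
  where "orthonormal_scaling_sequence M A V \<phi> \<longleftrightarrow>
    scaling_sequence M A V \<phi> \<and>
    (\<forall>j. orthonormal_family M (ker (A ^^ j)) (\<lambda>a. translate a (\<phi> j)))"

definition MRA ::
  "'a::topological_ab_group_add measure \<Rightarrow> ('a \<Rightarrow> 'a) \<Rightarrow> (nat \<Rightarrow> ('a \<Rightarrow> complex) set) \<Rightarrow> bool"
  where "MRA M A V \<longleftrightarrow>
    (\<forall>j. closed_l2_subspace M (V j)) \<and>
    (\<forall>j. V j \<subseteq> V (Suc j)) \<and>
    l2_closure M (\<Union>j. V j) = L2 M \<and>
    (\<forall>j. \<forall>\<gamma>\<in>ker (A ^^ j). \<forall>f\<in>L2 M. f \<in> V j \<longleftrightarrow> translate \<gamma> f \<in> V j) \<and>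
    (\<exists>\<phi>. scaling_sequence M A V \<phi>) \<and>
    (\<forall>j. \<forall>f\<in>V j. (\<lambda>x. f (A x)) \<in> V (Suc j)) \<and>
    (\<forall>j. \<forall>f\<in>V (Suc j). periodization A f \<in> V j)"


section \<open>The construction of the wavelet functions\<close>

definition digit_system ::
  "('a::topological_ab_group_add \<Rightarrow> 'a) \<Rightarrow> (nat \<Rightarrow> 'a dual_group) \<Rightarrow> bool"
  where "digit_system A \<pi> \<longleftrightarrow>
    \<pi> 0 = 0 \<and> (\<forall>\<xi>. \<exists>!k. k < card (ker A) \<and> \<xi> - \<pi> k \<in> annihilator (ker A))"

text \<open>\<open>digits A \<pi> j\<close> is \<open>D(A\<^sup>j)\<close>.\<close>

primrec digits ::
  "('a::topological_ab_group_add \<Rightarrow> 'a) \<Rightarrow> (nat \<Rightarrow> 'a dual_group) \<Rightarrow> nat \<Rightarrow> 'a dual_group set"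
  where
    "digits A \<pi> 0 = {0}"
  | "digits A \<pi> (Suc j) =
      {(adjoint_hom A ^^ j) (\<pi> k) + r | k r. k < card (ker A) \<and> r \<in> digits A \<pi> j}"

text \<open>\<open>refinement_mask M A \<phi> j \<eta>\<close> is the number written \<open>\<mu>\<close> with superscript \<open>j + 1\<close>
  and subscript \<open>\<eta>\<close>.\<close>

definition refinement_mask ::
  "'a::topological_ab_group_add measure \<Rightarrow> ('a \<Rightarrow> 'a) \<Rightarrow> (nat \<Rightarrow> 'a \<Rightarrow> complex)
    \<Rightarrow> nat \<Rightarrow> 'a dual_group \<Rightarrow> complex"
  where "refinement_mask M A \<phi> j \<eta> =
    (THE c. \<forall>\<xi>. \<xi> - \<eta> \<in> annihilator (ker (A ^^ Suc j)) \<longrightarrow>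
       fourier M (\<phi> j) \<xi> = c * fourier M (\<phi> (Suc j)) \<xi>)"

text \<open>Matrices of size \<open>m\<close> are functions considered for indices below \<open>m\<close> only.\<close>

definition unitary_matrix :: "nat \<Rightarrow> (nat \<Rightarrow> nat \<Rightarrow> complex) \<Rightarrow> bool"
  where "unitary_matrix m b \<longleftrightarrow>
    (\<forall>\<nu><m. \<forall>\<nu>'<m. (\<Sum>k<m. b \<nu> k * cnj (b \<nu>' k)) = (if \<nu> = \<nu>' then 1 else 0)) \<and>
    (\<forall>k<m. \<forall>k'<m. (\<Sum>\<nu><m. cnj (b \<nu> k) * b \<nu> k') = (if k = k' then 1 else 0))"

text \<open>\<open>wavelet_functions M A \<pi> \<phi> \<psi>\<close> says that the functions \<open>\<psi> \<nu> j\<close>, for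
  \<open>1 \<le> \<nu> < m\<close>, result from the scaling sequence \<open>\<phi>\<close> for some choice of the unitary matrices
  \<open>B j \<eta>\<close> extending the prescribed rows with index \<open>0\<close>.\<close>

definition wavelet_functions ::
  "'a::topological_ab_group_add measure \<Rightarrow> ('a \<Rightarrow> 'a) \<Rightarrow> (nat \<Rightarrow> 'a dual_group)
    \<Rightarrow> (nat \<Rightarrow> 'a \<Rightarrow> complex) \<Rightarrow> (nat \<Rightarrow> nat \<Rightarrow> 'a \<Rightarrow> complex) \<Rightarrow> bool"
  where "wavelet_functions M A \<pi> \<phi> \<psi> \<longleftrightarrow>
    (let m = card (ker A) in
     \<exists>(B :: nat \<Rightarrow> 'a dual_group \<Rightarrow> nat \<Rightarrow> nat \<Rightarrow> complex) (\<alpha> :: nat \<Rightarrow> nat \<Rightarrow> 'a dual_group \<Rightarrow> complex).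
       (\<forall>j. \<forall>\<eta>\<in>digits A \<pi> j. unitary_matrix m (B j \<eta>) \<and>
          (\<forall>k<m. B j \<eta> 0 k =
             refinement_mask M A \<phi> j (\<eta> + (adjoint_hom A ^^ j) (\<pi> k)) / of_real (sqrt (real m)))) \<and>
       (\<forall>\<nu>\<in>{1..<m}. \<forall>j. \<forall>\<eta>\<in>digits A \<pi> j. \<forall>k<m.
          \<alpha> \<nu> j (\<eta> + (adjoint_hom A ^^ j) (\<pi> k)) = of_real (sqrt (real m)) * B j \<eta> \<nu> k) \<and>
       (\<forall>\<nu>\<in>{1..<m}. \<forall>j. \<forall>\<eta>\<in>digits A \<pi> (Suc j). \<forall>\<xi>.
          \<xi> - \<eta> \<in> annihilator (ker (A ^^ Suc j)) \<longrightarrow> \<alpha> \<nu> j \<xi> = \<alpha> \<nu> j \<eta>) \<and>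
       (\<forall>\<nu>\<in>{1..<m}. \<forall>j. \<psi> \<nu> j \<in> L2 M \<and>
          (\<forall>\<xi>. fourier M (\<psi> \<nu> j) \<xi> = \<alpha> \<nu> j \<xi> * fourier M (\<phi> (Suc j)) \<xi>)))"

text \<open>The wavelet system is indexed by the triples \<open>(\<nu>, j, a)\<close>; the index \<open>None\<close> stands
  for the constant function.\<close>

definition wavelet_index :: "('a::ab_group_add \<Rightarrow> 'a) \<Rightarrow> (nat \<times> nat \<times> 'a) option set"
  where "wavelet_index A =
    insert None (Some ` {(\<nu>, j, a). \<nu> \<in> {1..<card (ker A)} \<and> a \<in> ker (A ^^ j)})"

fun wavelet_system ::
  "(nat \<Rightarrow> nat \<Rightarrow> 'a::ab_group_add \<Rightarrow> complex) \<Rightarrow> (nat \<times> nat \<times> 'a) option \<Rightarrow> 'a \<Rightarrow> complex"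
  where
    "wavelet_system \<psi> None = (\<lambda>_. 1)"
  | "wavelet_system \<psi> (Some (\<nu>, j, a)) = translate a (\<psi> \<nu> j)"

end

theory Submission
  imports Defs "HOL-Complex_Analysis.Great_Picard"
begin

text \<open>The argument is finite-dimensional linear algebra at each level, resting on one analytic fact:
  an \<open>L\<^sup>2\<close> function all of whose Fourier coefficients vanish is zero almost everywhere.

  \<^emph>\<open>The algebra.\<close> Put \<open>m = card (ker A)\<close> and \<open>K\<^sub>j = ker (A ^^ j)\<close>, a group of order \<open>m ^ j\<close>. The digits of
  level \<open>j\<close> restrict to all the characters of \<open>K\<^sub>j\<close>, each occurring once
  (\<open>complete_characters_digits\<close>). Averaging \<open>\<phi> j\<close> over \<open>K\<^sub>j\<close> against these characters gives pairwise
  orthogonal functions \<open>packet j \<xi>\<close> that span \<open>V j\<close>; translation by \<open>a \<in> K\<^sub>j\<close> multiplies \<open>packet j \<xi>\<close>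
  by a root of unity, and its Fourier transform is that of \<open>\<phi> j\<close> cut off to one coset of the annihilator
  of \<open>K\<^sub>j\<close>. A function whose Fourier transform is that of \<open>\<phi> (j + 1)\<close> times a function of the coset is
  therefore a combination of packets of level \<open>j + 1\<close> with those coefficients
  (\<open>multiplier_AE\<close>). This applies to \<open>\<psi> \<nu> j\<close> and, with the refinement mask as multiplier, to \<open>\<phi> j\<close>.
  In these coordinates the translates of \<open>\<phi> j, \<psi> 1 j, \<dots>, \<psi> (m - 1) j\<close> by \<open>K\<^sub>j\<close> arise from the
  packets of level \<open>j + 1\<close> by the unitary matrices of the construction, combined with the character table
  of \<open>K\<^sub>j\<close>. Orthonormality of their rows makes the translates orthonormal (\<open>W_orthonormal\<close>), and
  orthonormality of their columns recovers the packets (\<open>packet_W_span\<close>). So the wavelets of level \<open>j\<close>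
  form an orthonormal basis of the orthogonal complement of \<open>V j\<close> in \<open>V (j + 1)\<close>, and the theorem
  follows because \<open>V 0\<close> consists of the constants and the union of the \<open>V j\<close> is dense.

  \<^emph>\<open>The analysis.\<close> Uniqueness of Fourier coefficients (\<open>fourier_eq_0_imp_AE\<close>) follows from the density
  of the finite subgroups \<open>K\<^sub>j\<close>. For \<open>g\<close> of positive norm the autocorrelation
  \<open>k x = \<langle>g(\<cdot> + x), g\<rangle>\<close> is continuous and positive definite. Parseval's identity on \<open>K\<^sub>j\<close>, together with
  the fact that \<open>K\<^sub>j\<close> returns to a neighbourhood of \<open>0\<close> with frequency bounded below, yields characters
  \<open>\<gamma> j\<close> for which the average of \<open>k\<close> over \<open>K\<^sub>j\<close> against \<open>\<gamma> j\<close> stays away from \<open>0\<close>. The functions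
  \<open>x \<mapsto> average of cnj (\<gamma> j a) * k (x + a) over a \<in> K\<^sub>j\<close> are equicontinuous, so a subsequence
  converges; the limit is a nonzero multiple of a character \<open>\<theta>\<close>, and it satisfies \<open>\<langle>k, \<theta>\<rangle> \<noteq> 0\<close>. Since
  \<open>\<langle>k, \<theta>\<rangle>\<close> is the squared modulus of the Fourier coefficient of \<open>g\<close> at \<open>\<theta>\<close>, that coefficient is nonzero.\<close>

section \<open>Square integrable functions\<close>

locale second_countable_haar = normalized_haar M
  for M :: "'a::{topological_ab_group_add, second_countable_topology} measure"
begin

declare sets_eq_borel [measurable_cong]

lemma space_M [simp]: "space M = UNIV"
  using sets_eq_imp_space_eq[OF sets_eq_borel] by simp

lemma measurable_minus_const [measurable]: "(\<lambda>x. x - y) \<in> measurable M M"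
proof -
  have "(\<lambda>x::'a. x - y) \<in> borel_measurable borel"
    by (intro borel_measurable_continuous_onI continuous_intros)
  then show ?thesis
    by (subst measurable_cong_sets[OF sets_eq_borel sets_eq_borel])
qed

lemma borel_measurable_translate [measurable]:
  "f \<in> borel_measurable M \<Longrightarrow> translate y f \<in> borel_measurable M"
  unfolding translate_def by (rule measurable_compose[OF measurable_minus_const])

lemma distr_minus: "distr M M (\<lambda>x. x - y) = M"
proof -
  have "distr M M (\<lambda>x. x - y) = distr M borel ((+) (- y))"
    by (rule distr_cong) (auto simp: sets_eq_borel)
  then show ?thesis by (simp add: translation_invariant)
qed

lemma integral_minus:
  fixes f :: "'a \<Rightarrow> 'b::{banach, second_countable_topology}"
  assumes "f \<in> borel_measurable M"
  shows "(LINT x|M. f (x - y)) = (LINT x|M. f x)"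
proof -
  have "(LINT x|distr M M (\<lambda>x. x - y). f x) = (LINT x|M. f (x - y))"
    by (rule integral_distr) (use assms in auto)
  then show ?thesis by (simp add: distr_minus)
qed

lemma integrable_minus:
  fixes f :: "'a \<Rightarrow> 'b::{banach, second_countable_topology}"
  assumes "integrable M f"
  shows "integrable M (\<lambda>x. f (x - y))"
proof -
  have "integrable (distr M M (\<lambda>x. x - y)) f"
    using assms by (simp add: distr_minus)
  then show ?thesis
    by (rule integrable_distr[rotated]) auto
qed

lemma AE_minus:
  assumes "AE x in M. P x"
  shows "AE x in M. P (x - y)"
proof -
  have "AE x in distr M M (\<lambda>x. x - y). P x"
    unfolding distr_minus by (rule assms)
  then show ?thesis
    by (rule AE_distrD[rotated]) auto
qed

lemma AE_translate:
  "AE x in M. f x = g x \<Longrightarrow> AE x in M. translate y f x = translate y g x"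
  unfolding translate_def by (rule AE_minus)

lemma L2_measurable [measurable_dest]: "f \<in> L2 M \<Longrightarrow> f \<in> borel_measurable M"
  by (simp add: L2_def)

lemma L2_integrable_sq: "f \<in> L2 M \<Longrightarrow> integrable M (\<lambda>x. (cmod (f x))\<^sup>2)"
  by (simp add: L2_def)

text \<open>Membership in \<open>L\<^sup>2\<close> is always obtained by comparison with a function already known to be there.\<close>

lemma L2_dominated:
  assumes [measurable]: "f \<in> borel_measurable M" and g: "g \<in> L2 M"
    and le: "AE x in M. cmod (f x) \<le> c * cmod (g x)"
  shows "f \<in> L2 M"
proof -
  have "integrable M (\<lambda>x. (cmod (f x))\<^sup>2)"
  proof (rule Bochner_Integration.integrable_bound)
    show "integrable M (\<lambda>x. c\<^sup>2 * (cmod (g x))\<^sup>2)"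
      using L2_integrable_sq[OF g] by simp
    show "AE x in M. norm ((cmod (f x))\<^sup>2) \<le> norm (c\<^sup>2 * (cmod (g x))\<^sup>2)"
      using le
    proof eventually_elim
      case (elim x)
      then have "(cmod (f x))\<^sup>2 \<le> (c * cmod (g x))\<^sup>2"
        by (rule power_mono) simp
      then show ?case by (simp add: power_mult_distrib)
    qed
  qed simp
  then show ?thesis by (simp add: L2_def)
qed

lemma L2_bounded:
  assumes [measurable]: "f \<in> borel_measurable M" and le: "\<And>x. cmod (f x) \<le> c"
  shows "f \<in> L2 M"
  by (rule L2_dominated[where g = "\<lambda>_. 1" and c = c]) (use le in \<open>auto simp: L2_def\<close>)

lemma L2_0 [simp]: "(\<lambda>_. 0) \<in> L2 M"
  by (simp add: L2_def)

lemma cmod_add_sq_le: "(cmod (a + b))\<^sup>2 \<le> 2 * (cmod a)\<^sup>2 + 2 * (cmod b)\<^sup>2"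
proof -
  have "(cmod (a + b))\<^sup>2 \<le> (cmod a + cmod b)\<^sup>2"
    by (rule power_mono[OF norm_triangle_ineq]) simp
  also have "\<dots> \<le> 2 * (cmod a)\<^sup>2 + 2 * (cmod b)\<^sup>2"
    using sum_squares_bound[of "cmod a" "cmod b"] by (simp add: power2_sum)
  finally show ?thesis .
qed

lemma L2_add:
  assumes f: "f \<in> L2 M" and g: "g \<in> L2 M"
  shows "(\<lambda>x. f x + g x) \<in> L2 M"
proof -
  note [measurable] = L2_measurable[OF f] L2_measurable[OF g]
  have "integrable M (\<lambda>x. (cmod (f x + g x))\<^sup>2)"
    by (rule Bochner_Integration.integrable_bound
        [where f = "\<lambda>x. 2 * (cmod (f x))\<^sup>2 + 2 * (cmod (g x))\<^sup>2"])
      (use L2_integrable_sq[OF f] L2_integrable_sq[OF g] cmod_add_sq_le in auto)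
  then show ?thesis by (simp add: L2_def)
qed

lemma L2_scale: "f \<in> L2 M \<Longrightarrow> (\<lambda>x. c * f x) \<in> L2 M"
  by (rule L2_dominated[where g = f and c = "cmod c"]) (auto simp: norm_mult)

lemma L2_diff:
  assumes "f \<in> L2 M" "g \<in> L2 M"
  shows "(\<lambda>x. f x - g x) \<in> L2 M"
  using L2_add[OF assms(1) L2_scale[OF assms(2), of "-1"]] by simp

lemma L2_sum:
  assumes "\<And>i. i \<in> I \<Longrightarrow> f i \<in> L2 M"
  shows "(\<lambda>x. \<Sum>i\<in>I. f i x) \<in> L2 M"
  using assms by (induction I rule: infinite_finite_induct) (auto intro: L2_add)

lemma L2_translate: "f \<in> L2 M \<Longrightarrow> translate y f \<in> L2 M"
  using integrable_minus[of "\<lambda>x. (cmod (f x))\<^sup>2" y] borel_measurable_translate[of f y]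
  by (auto simp: L2_def translate_def)

lemma L2_prod_integrable:
  assumes f: "f \<in> L2 M" and g: "g \<in> L2 M"
  shows "integrable M (\<lambda>x. f x * cnj (g x))"
proof -
  note [measurable] = L2_measurable[OF f] L2_measurable[OF g]
  show ?thesis
  proof (rule Bochner_Integration.integrable_bound
      [where f = "\<lambda>x. (cmod (f x))\<^sup>2 + (cmod (g x))\<^sup>2"])
    show "AE x in M. norm (f x * cnj (g x)) \<le> norm ((cmod (f x))\<^sup>2 + (cmod (g x))\<^sup>2)"
    proof (rule AE_I2)
      fix x
      have "cmod (f x) * cmod (g x) \<ge> 0" by simp
      then show "norm (f x * cnj (g x)) \<le> norm ((cmod (f x))\<^sup>2 + (cmod (g x))\<^sup>2)"
        using sum_squares_bound[of "cmod (f x)" "cmod (g x)"] unfolding norm_mult complex_mod_cnj real_norm_def by linarith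
    qed
    show "(\<lambda>x. f x * cnj (g x)) \<in> borel_measurable M"
    proof (rule borel_measurable_times)
      have "(cnj :: complex \<Rightarrow> complex) \<in> borel_measurable borel"
        by (intro borel_measurable_continuous_onI continuous_intros)
      then show "(\<lambda>x. cnj (g x)) \<in> borel_measurable M"
        by (rule measurable_compose[OF L2_measurable[OF g]])
    qed (rule L2_measurable[OF f])
  qed (use L2_integrable_sq[OF f] L2_integrable_sq[OF g] in auto)
qed

lemma inner_scale_left: "l2_inner M (\<lambda>x. c * f x) h = c * l2_inner M f h"
  by (simp add: l2_inner_def mult.assoc)

lemma inner_cnj: "l2_inner M g f = cnj (l2_inner M f g)"
  unfolding l2_inner_def Bochner_Integration.integral_cnj[symmetric]
  by (simp add: mult.commute)

lemma inner_scale_right: "l2_inner M f (\<lambda>x. c * h x) = cnj c * l2_inner M f h"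
  by (subst (1 2) inner_cnj) (simp add: inner_scale_left)

lemma inner_diff_left:
  assumes "f \<in> L2 M" "g \<in> L2 M" "h \<in> L2 M"
  shows "l2_inner M (\<lambda>x. f x - g x) h = l2_inner M f h - l2_inner M g h"
  using L2_prod_integrable[OF assms(1,3)] L2_prod_integrable[OF assms(2,3)]
  by (simp add: l2_inner_def left_diff_distrib)

lemma inner_sum_left:
  assumes "\<And>i. i \<in> I \<Longrightarrow> e i \<in> L2 M" and "h \<in> L2 M"
  shows "l2_inner M (\<lambda>x. \<Sum>i\<in>I. c i * e i x) h = (\<Sum>i\<in>I. c i * l2_inner M (e i) h)"
proof -
  have "integrable M (\<lambda>x. c i * (e i x * cnj (h x)))" if "i \<in> I" for i
    using L2_prod_integrable[OF assms(1)[OF that] assms(2)] by simp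
  then show ?thesis
    by (simp add: l2_inner_def sum_distrib_right mult.assoc)
qed

lemma inner_sum_right:
  assumes "\<And>i. i \<in> I \<Longrightarrow> e i \<in> L2 M" and "h \<in> L2 M"
  shows "l2_inner M h (\<lambda>x. \<Sum>i\<in>I. c i * e i x) = (\<Sum>i\<in>I. cnj (c i) * l2_inner M h (e i))"
  by (subst inner_cnj, subst inner_sum_left) (use assms in \<open>auto simp: inner_cnj[symmetric]\<close>)

lemma inner_cong_AE:
  assumes "f \<in> L2 M" "f' \<in> L2 M" "g \<in> L2 M" "g' \<in> L2 M"
    and "AE x in M. f x = f' x" "AE x in M. g x = g' x"
  shows "l2_inner M f g = l2_inner M f' g'"
  unfolding l2_inner_def
proof (rule integral_cong_AE)
  show "AE x in M. f x * cnj (g x) = f' x * cnj (g' x)"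
    using assms(5,6) by eventually_elim simp
qed (use assms in \<open>auto intro: borel_measurable_integrable[OF L2_prod_integrable]\<close>)

lemma inner_translate:
  assumes "f \<in> L2 M" "g \<in> L2 M"
  shows "l2_inner M (translate a f) (translate b g) = l2_inner M (translate (a - b) f) g"
proof -
  have "(\<lambda>x. translate (a - b) f x * cnj (g x)) \<in> borel_measurable M"
    using assms by (intro borel_measurable_integrable L2_prod_integrable L2_translate)
  from integral_minus[OF this, of b] show ?thesis
    by (simp add: l2_inner_def translate_def algebra_simps)
qed

lemma inner_self: "l2_inner M f f = of_real (LINT x|M. (cmod (f x))\<^sup>2)"
  unfolding l2_inner_def complex_norm_square[symmetric] by (rule integral_complex_of_real)

lemma l2_norm_nonneg: "0 \<le> l2_norm M f"
  by (simp add: l2_norm_def)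

lemma l2_norm_sq: "(l2_norm M f)\<^sup>2 = (LINT x|M. (cmod (f x))\<^sup>2)"
  by (simp add: l2_norm_def)

lemma l2_norm_translate:
  assumes "f \<in> L2 M"
  shows "l2_norm M (translate y f) = l2_norm M f"
  using integral_minus[of "\<lambda>x. (cmod (f x))\<^sup>2" y] L2_measurable[OF assms]
  by (simp add: l2_norm_def translate_def)

lemma cauchy_schwarz:
  assumes f: "f \<in> L2 M" and g: "g \<in> L2 M"
  shows "cmod (l2_inner M f g) \<le> l2_norm M f * l2_norm M g"
proof -
  note [measurable] = L2_measurable[OF f] L2_measurable[OF g]
  define I where "I = (LINT x|M. cmod (f x) * cmod (g x))"
  have int: "integrable M (\<lambda>x. cmod (f x) * cmod (g x))"
    using integrable_norm[OF L2_prod_integrable[OF f g]] by (simp add: norm_mult)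
  have I0: "0 \<le> I" unfolding I_def by (rule integral_nonneg_AE) simp
  have "cmod (l2_inner M f g) \<le> I"
    unfolding l2_inner_def I_def
    by (rule order_trans[OF integral_norm_bound]) (simp add: norm_mult)
  moreover have "I\<^sup>2 \<le> (l2_norm M f)\<^sup>2 * (l2_norm M g)\<^sup>2"
  proof -
    have "(\<integral>\<^sup>+x. ennreal (cmod (f x)) * ennreal (cmod (g x)) \<partial>M)\<^sup>2
        \<le> (\<integral>\<^sup>+x. (ennreal (cmod (f x)))\<^sup>2 \<partial>M) * (\<integral>\<^sup>+x. (ennreal (cmod (g x)))\<^sup>2 \<partial>M)"
      by (rule Cauchy_Schwarz_nn_integral) auto
    also have "(\<integral>\<^sup>+x. ennreal (cmod (f x)) * ennreal (cmod (g x)) \<partial>M) = ennreal I"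
      unfolding I_def using int
      by (subst nn_integral_eq_integral[symmetric]) (auto simp: ennreal_mult)
    also have "(\<integral>\<^sup>+x. (ennreal (cmod (f x)))\<^sup>2 \<partial>M) = ennreal ((l2_norm M f)\<^sup>2)"
      unfolding l2_norm_sq using L2_integrable_sq[OF f]
      by (subst nn_integral_eq_integral[symmetric]) (auto simp: ennreal_power)
    also have "(\<integral>\<^sup>+x. (ennreal (cmod (g x)))\<^sup>2 \<partial>M) = ennreal ((l2_norm M g)\<^sup>2)"
      unfolding l2_norm_sq using L2_integrable_sq[OF g]
      by (subst nn_integral_eq_integral[symmetric]) (auto simp: ennreal_power)
    finally show ?thesis
      using I0 by (simp add: ennreal_power ennreal_mult[symmetric])
  qed
  then have "I \<le> l2_norm M f * l2_norm M g"
    by (simp add: power_mult_distrib[symmetric] power2_le_iff_abs_le l2_norm_nonneg I0)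
  ultimately show ?thesis by simp
qed

lemma l2_norm_eq_0_imp_AE:
  assumes f: "f \<in> L2 M" and "l2_norm M f = 0"
  shows "AE x in M. f x = 0"
  using assms integral_nonneg_eq_0_iff_AE[OF L2_integrable_sq[OF f]]
  by (simp add: l2_norm_def)

end

section \<open>Continuity of translation in the mean\<close>

context second_countable_haar
begin

text \<open>Functions satisfying the conclusion form a subspace closed under dominated pointwise limits, so it is
  enough to treat indicators; those of open sets are handled directly, and the remaining Borel sets
  follow by a Dynkin argument.\<close>

definition shift_error :: "('a \<Rightarrow> complex) \<Rightarrow> 'a \<Rightarrow> real"
  where "shift_error f y = (LINT x|M. (cmod (f (x - y) - f x))\<^sup>2)"

definition shift_continuous :: "('a \<Rightarrow> complex) \<Rightarrow> bool"
  where "shift_continuous f \<longleftrightarrow> f \<in> L2 M \<and> (shift_error f \<longlongrightarrow> 0) (nhds 0)"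

lemma shift_error_nonneg: "0 \<le> shift_error f y"
  by (simp add: shift_error_def)

lemma L2_shift_diff: "f \<in> L2 M \<Longrightarrow> (\<lambda>x. f (x - y) - f x) \<in> L2 M"
  using L2_diff[OF L2_translate[of f y], of f] by (simp add: translate_def)

lemma integral_sq_add_le:
  assumes "f \<in> L2 M" "g \<in> L2 M"
  shows "(LINT x|M. (cmod (f x + g x))\<^sup>2)
    \<le> 2 * (LINT x|M. (cmod (f x))\<^sup>2) + 2 * (LINT x|M. (cmod (g x))\<^sup>2)"
proof -
  note [simp] = L2_integrable_sq[OF assms(1)] L2_integrable_sq[OF assms(2)]
    L2_integrable_sq[OF L2_add[OF assms]]
  have "(LINT x|M. (cmod (f x + g x))\<^sup>2)
      \<le> (LINT x|M. 2 * (cmod (f x))\<^sup>2 + 2 * (cmod (g x))\<^sup>2)"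
    by (rule integral_mono) (auto simp: cmod_add_sq_le)
  then show ?thesis by simp
qed

lemma shift_error_add_le:
  assumes "f \<in> L2 M" "g \<in> L2 M"
  shows "shift_error (\<lambda>x. f x + g x) y \<le> 2 * shift_error f y + 2 * shift_error g y"
  using integral_sq_add_le[OF L2_shift_diff[OF assms(1), of y] L2_shift_diff[OF assms(2), of y]]
  by (simp add: shift_error_def algebra_simps)

lemma shift_error_le:
  assumes f: "f \<in> L2 M"
  shows "shift_error f y \<le> 4 * (LINT x|M. (cmod (f x))\<^sup>2)"
proof -
  have "shift_error f y \<le> 2 * (LINT x|M. (cmod (f (x - y)))\<^sup>2) + 2 * (LINT x|M. (cmod (f x))\<^sup>2)"
    using integral_sq_add_le[OF L2_translate[OF f, of y] L2_scale[OF f, of "-1"]]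
    by (simp add: shift_error_def translate_def)
  moreover have "(LINT x|M. (cmod (f (x - y)))\<^sup>2) = (LINT x|M. (cmod (f x))\<^sup>2)"
    by (rule integral_minus[where f = "\<lambda>x. (cmod (f x))\<^sup>2"]) (use L2_measurable[OF f] in measurable)
  ultimately show ?thesis by simp
qed

lemma shift_continuous_add:
  assumes "shift_continuous f" "shift_continuous g"
  shows "shift_continuous (\<lambda>x. f x + g x)"
  unfolding shift_continuous_def
proof
  show "(\<lambda>x. f x + g x) \<in> L2 M"
    using assms by (auto simp: shift_continuous_def intro: L2_add)
  have "((\<lambda>y. 2 * shift_error f y + 2 * shift_error g y) \<longlongrightarrow> 2 * 0 + 2 * 0) (nhds 0)"
    using assms unfolding shift_continuous_def by (intro tendsto_intros) auto
  then have "((\<lambda>y. 2 * shift_error f y + 2 * shift_error g y) \<longlongrightarrow> 0) (nhds 0)"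
    by simp
  then show "(shift_error (\<lambda>x. f x + g x) \<longlongrightarrow> 0) (nhds 0)"
  proof (rule tendsto_sandwich[rotated 3])
    show "\<forall>\<^sub>F y in nhds 0. shift_error (\<lambda>x. f x + g x) y \<le> 2 * shift_error f y + 2 * shift_error g y"
      using assms by (intro always_eventually allI shift_error_add_le) (auto simp: shift_continuous_def)
    show "\<forall>\<^sub>F y in nhds 0. 0 \<le> shift_error (\<lambda>x. f x + g x) y"
      by (intro always_eventually allI shift_error_nonneg)
  qed (rule tendsto_const)
qed

lemma shift_continuous_scale:
  assumes "shift_continuous f"
  shows "shift_continuous (\<lambda>x. c * f x)"
proof -
  have "shift_error (\<lambda>x. c * f x) = (\<lambda>y. (cmod c)\<^sup>2 * shift_error f y)"
    by (simp add: shift_error_def fun_eq_iff right_diff_distrib[symmetric] norm_mult power_mult_distrib)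
  then show ?thesis
    using assms tendsto_mult_right_zero[of "shift_error f" "nhds 0" "(cmod c)\<^sup>2"]
    by (auto simp: shift_continuous_def L2_scale)
qed

lemma shift_continuous_0: "shift_continuous (\<lambda>_. 0)"
  unfolding shift_continuous_def shift_error_def[abs_def] by simp

lemma shift_continuous_sum:
  assumes "\<And>i. i \<in> I \<Longrightarrow> shift_continuous (f i)"
  shows "shift_continuous (\<lambda>x. \<Sum>i\<in>I. f i x)"
  using assms
proof (induction I rule: infinite_finite_induct)
  case (insert i I)
  then show ?case
    using shift_continuous_add[of "f i" "\<lambda>x. \<Sum>i\<in>I. f i x"] by simp
next
  case (infinite I)
  then show ?case using shift_continuous_0 by simp
next
  case empty
  show ?case using shift_continuous_0 by simp
qed

text \<open>If \<open>r\<close> is the squared distance from \<open>f\<close> to an approximant \<open>s\<close>, then splitting \<open>f = s + (f - s)\<close>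
  bounds the shift error of \<open>f\<close> by twice that of \<open>s\<close> plus \<open>8 * r\<close>, uniformly in the shift.\<close>

lemma shift_continuous_limit:
  assumes s: "\<And>i::nat. shift_continuous (s i)" and f: "f \<in> L2 M"
    and lim: "\<And>x. (\<lambda>i. s i x) \<longlonglongrightarrow> f x" and le: "\<And>i x. cmod (s i x) \<le> 2 * cmod (f x)"
  shows "shift_continuous f"
proof -
  have sL2: "s i \<in> L2 M" for i
    using s by (simp add: shift_continuous_def)
  note [measurable] = L2_measurable[OF f] L2_measurable[OF sL2]
  define r where "r i = (LINT x|M. (cmod (f x - s i x))\<^sup>2)" for i
  have "r \<longlonglongrightarrow> (LINT x|M. 0)"
    unfolding r_def
  proof (rule integral_dominated_convergence)
    \<comment> \<open>The bound \<open>2 * cmod (f x)\<close> on the approximants gives \<open>cmod (f x - s i x) \<le> 3 * cmod (f x)\<close>.\<close>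
    show "integrable M (\<lambda>x. 9 * (cmod (f x))\<^sup>2)"
      using L2_integrable_sq[OF f] by simp
    show "AE x in M. (\<lambda>i. (cmod (f x - s i x))\<^sup>2) \<longlonglongrightarrow> 0"
    proof (rule AE_I2)
      fix x
      have "(\<lambda>i. (cmod (f x - s i x))\<^sup>2) \<longlonglongrightarrow> (cmod (f x - f x))\<^sup>2"
        by (intro tendsto_intros lim)
      then show "(\<lambda>i. (cmod (f x - s i x))\<^sup>2) \<longlonglongrightarrow> 0" by simp
    qed
    show "AE x in M. norm ((cmod (f x - s i x))\<^sup>2) \<le> 9 * (cmod (f x))\<^sup>2" for i
    proof (rule AE_I2)
      fix x
      have "cmod (f x - s i x) \<le> 3 * cmod (f x)"
        using norm_triangle_ineq4[of "f x" "s i x"] le[of i x] by simp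
      then have "(cmod (f x - s i x))\<^sup>2 \<le> (3 * cmod (f x))\<^sup>2"
        by (rule power_mono) simp
      then show "norm ((cmod (f x - s i x))\<^sup>2) \<le> 9 * (cmod (f x))\<^sup>2"
        by (simp add: power_mult_distrib)
    qed
  qed auto
  then have r: "r \<longlonglongrightarrow> 0" by simp
  have split: "shift_error f y \<le> 2 * shift_error (s i) y + 8 * r i" for i y
  proof -
    have "shift_error (\<lambda>x. s i x + (f x - s i x)) y
        \<le> 2 * shift_error (s i) y + 2 * shift_error (\<lambda>x. f x - s i x) y"
      by (rule shift_error_add_le[OF sL2 L2_diff[OF f sL2]])
    moreover have "shift_error (\<lambda>x. f x - s i x) y \<le> 4 * r i"
      unfolding r_def by (rule shift_error_le[OF L2_diff[OF f sL2]])
    ultimately show ?thesis by simp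
  qed
  have "(shift_error f \<longlongrightarrow> 0) (nhds 0)"
  proof (rule tendstoI)
    fix e :: real assume e: "e > 0"
    from order_tendstoD(2)[OF r, of "e / 16"] e obtain i where i: "r i < e / 16"
      by (auto simp: eventually_sequentially)
    have "(shift_error (s i) \<longlongrightarrow> 0) (nhds 0)"
      using s[of i] by (simp add: shift_continuous_def)
    from order_tendstoD(2)[OF this, of "e / 4"] e
    have "\<forall>\<^sub>F y in nhds 0. shift_error (s i) y < e / 4" by simp
    then show "\<forall>\<^sub>F y in nhds 0. dist (shift_error f y) 0 < e"
    proof eventually_elim
      case (elim y)
      then show ?case using split[of y i] i shift_error_nonneg[of f y] by simp
    qed
  qed
  with f show ?thesis by (simp add: shift_continuous_def)
qed

lemma L2_indicator: "B \<in> sets borel \<Longrightarrow> indicator B \<in> L2 M"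
  by (rule L2_bounded[where c = 1]) (auto simp: indicator_def sets_eq_borel)

text \<open>For a neighbourhood \<open>W\<close> of \<open>0\<close> the set \<open>C\<close> of the points \<open>x\<close> with \<open>x + W \<subseteq> U\<close> is closed, and a shift by an
  element of \<open>W\<close> keeps \<open>C\<close> inside \<open>U\<close>. Hence the symmetric difference of \<open>U\<close> and its shift has measure
  at most \<open>2 * (prob U - prob C)\<close>, which tends to \<open>0\<close> as \<open>W\<close> runs through a countable neighbourhood base.\<close>

lemma shift_continuous_indicator_open:
  assumes U: "open U"
  shows "shift_continuous (indicator U)"
proof -
  obtain W :: "nat \<Rightarrow> 'a set" where W: "\<And>i. open (W i)" "\<And>i. 0 \<in> W i"
    and W_sub: "\<And>S. open S \<Longrightarrow> 0 \<in> S \<Longrightarrow> eventually (\<lambda>i. W i \<subseteq> S) sequentially"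
    by (rule countable_basis_at_decseq[of 0]) blast
  define C where "C i = {x. \<forall>w\<in>W i. x + w \<in> U}" for i
  have "open (- C i)" for i
  proof -
    have "- C i = (\<Union>u\<in>-U. (\<lambda>x. u - x) -` W i)"
    proof (intro set_eqI iffI)
      fix x assume "x \<in> - C i"
      then obtain w where "w \<in> W i" "x + w \<notin> U" by (auto simp: C_def)
      then show "x \<in> (\<Union>u\<in>-U. (\<lambda>x. u - x) -` W i)"
        by (auto intro!: bexI[of _ "x + w"])
    next
      fix x assume "x \<in> (\<Union>u\<in>-U. (\<lambda>x. u - x) -` W i)"
      then obtain u where "u \<notin> U" "u - x \<in> W i" by auto
      then show "x \<in> - C i" by (auto simp: C_def intro!: bexI[of _ "u - x"])
    qed
    then show ?thesis
      by (auto intro!: open_UN open_vimage W continuous_intros)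
  qed
  then have C_meas [measurable]: "C i \<in> sets M" for i
    by (simp add: sets_eq_borel closed_def[symmetric] borel_closed)
  have U_meas [measurable]: "U \<in> sets M"
    using U by (simp add: sets_eq_borel)
  have C_sub: "C i \<subseteq> U" for i
    using W(2)[of i] by (force simp: C_def)
  have "(\<lambda>i. (LINT x|M. indicator (C i) x)) \<longlonglongrightarrow> (LINT x|M. (indicator U x :: real))"
  proof (rule integral_dominated_convergence[where w = "\<lambda>_. 1"])
    show "AE x in M. (\<lambda>i. indicator (C i) x :: real) \<longlonglongrightarrow> indicator U x"
    proof (rule AE_I2)
      fix x
      show "(\<lambda>i. indicator (C i) x :: real) \<longlonglongrightarrow> indicator U x"
      proof (cases "x \<in> U")
        case True
        have "open ((\<lambda>w. x + w) -` U)"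
          by (intro open_vimage U continuous_intros)
        with True have "eventually (\<lambda>i. W i \<subseteq> (\<lambda>w. x + w) -` U) sequentially"
          by (intro W_sub) auto
        then have "eventually (\<lambda>i. indicator (C i) x = (1::real)) sequentially"
          by eventually_elim (auto simp: C_def indicator_def)
        with True show ?thesis by (simp add: tendsto_eventually)
      next
        case False
        then have "indicator (C i) x = (0::real)" for i using C_sub[of i] by (auto simp: indicator_def)
        with False show ?thesis by simp
      qed
    qed
  qed (auto simp: indicator_def)
  then have lim: "(\<lambda>i. prob (C i)) \<longlonglongrightarrow> prob U" by simp
  have est: "shift_error (indicator U) y \<le> 2 * prob U - 2 * prob (C i)" if y: "y \<in> W i" for y i
  proof -
    have int: "integrable M (\<lambda>x. indicator B (x - y) :: real)" if "B \<in> sets M" for B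
      by (rule integrable_minus) (use that in \<open>auto simp: less_top[symmetric]\<close>)
    have eq: "(LINT x|M. (indicator B (x - y) :: real)) = prob B" if "B \<in> sets M" for B
      by (subst integral_minus) (use that in auto)
    have "shift_error (indicator U) y
        \<le> (LINT x|M. indicator U (x - y) + indicator U x - 2 * indicator (C i) (x - y))"
      unfolding shift_error_def
    proof (rule integral_mono)
      show "integrable M (\<lambda>x. (cmod (indicator U (x - y) - indicator U x))\<^sup>2)"
        using L2_integrable_sq[OF L2_shift_diff[OF L2_indicator, of U y]] U by simp
      show "integrable M (\<lambda>x. indicator U (x - y) + indicator U x - 2 * indicator (C i) (x - y) :: real)"
        by (intro Bochner_Integration.integrable_add Bochner_Integration.integrable_diff
            integrable_mult_right int) (auto simp: less_top[symmetric])
      fix x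
      have "x - y \<in> C i \<Longrightarrow> x - y \<in> U \<and> x \<in> U"
        using y C_sub[of i] by (force simp: C_def)
      then show "(cmod (indicator U (x - y) - indicator U x))\<^sup>2
          \<le> indicator U (x - y) + indicator U x - 2 * indicator (C i) (x - y)"
        by (auto simp: indicator_def)
    qed
    also have "\<dots> = prob U + prob U - 2 * prob (C i)"
      using int[OF U_meas] int[OF C_meas[of i]] eq[OF U_meas] eq[OF C_meas[of i]]
        integrable_real_indicator[OF U_meas]
      by (simp add: less_top[symmetric])
    finally show ?thesis by simp
  qed
  have "(shift_error (indicator U) \<longlongrightarrow> 0) (nhds 0)"
  proof (rule tendstoI)
    fix e :: real assume e: "e > 0"
    from order_tendstoD(1)[OF lim, of "prob U - e / 2"] e
    obtain i where i: "prob U - e / 2 < prob (C i)"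
      by (auto simp: eventually_sequentially)
    have "\<forall>\<^sub>F y in nhds 0. y \<in> W i"
      using W by (auto intro: eventually_nhds_in_open)
    then show "\<forall>\<^sub>F y in nhds 0. dist (shift_error (indicator U) y) 0 < e"
    proof eventually_elim
      case (elim y)
      then show ?case
        using est[OF elim] i shift_error_nonneg[of "indicator U" y] by simp
    qed
  qed
  then show ?thesis
    using U by (simp add: shift_continuous_def L2_indicator)
qed

lemma shift_continuous_indicator:
  assumes "B \<in> sets borel"
  shows "shift_continuous (indicator B)"
proof -
  have "Int_stable {S :: 'a set. open S}"
    by (auto simp: Int_stable_def)
  moreover have "{S :: 'a set. open S} \<subseteq> Pow UNIV" by simp
  moreover have "B \<in> sigma_sets UNIV {S. open S}"
    using assms by (simp add: borel_def)
  ultimately show ?thesis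
  proof (induction rule: sigma_sets_induct_disjoint)
    case (basic A)
    then show ?case by (simp add: shift_continuous_indicator_open)
  next
    case empty
    then show ?case using shift_continuous_0 by (simp add: indicator_def[abs_def])
  next
    case (compl A)
    have "shift_continuous (\<lambda>x. indicator UNIV x + (-1) * indicator A x)"
      by (intro shift_continuous_add shift_continuous_scale shift_continuous_indicator_open compl) simp
    moreover have "(\<lambda>x. indicator UNIV x + (-1) * indicator A x) = (indicator (UNIV - A) :: 'a \<Rightarrow> complex)"
      by (auto simp: indicator_def)
    ultimately show ?case by simp
  next
    case (union A)
    have "range A \<subseteq> sets borel"
      using union(2) by (simp add: borel_def)
    show ?case
    proof (rule shift_continuous_limit[where s = "\<lambda>n x. \<Sum>i<n. indicator (A i) x"])
      show "shift_continuous (\<lambda>x. \<Sum>i<n. indicator (A i) x)" for n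
        by (intro shift_continuous_sum union)
      show "indicator (\<Union>i. A i) \<in> L2 M"
        using \<open>range A \<subseteq> sets borel\<close> by (intro L2_indicator) auto
      have eq: "(\<Sum>i<n. indicator (A i) x) = (indicator (\<Union>i<n. A i) x :: complex)" for n x
        using union(1) by (subst indicator_UN_disjoint) (auto simp: disjoint_family_on_def)
      show "(\<lambda>n. \<Sum>i<n. indicator (A i) x) \<longlonglongrightarrow> (indicator (\<Union>i. A i) x :: complex)" for x
        unfolding eq by (rule LIMSEQ_indicator_UN)
      show "cmod (\<Sum>i<n. indicator (A i) x) \<le> 2 * cmod (indicator (\<Union>i. A i) x)" for n x
        unfolding eq by (auto simp: indicator_def)
    qed
  qed
qed

proposition L2_shift_continuous:
  assumes f: "f \<in> L2 M"
  shows "shift_continuous f"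
proof -
  from borel_measurable_implies_sequence_metric[OF L2_measurable[OF f], of 0]
  obtain s where s: "\<And>i. simple_function M (s i)"
    and lim: "\<And>x. (\<lambda>i. s i x) \<longlonglongrightarrow> f x" and le: "\<And>i x. cmod (s i x) \<le> 2 * cmod (f x)"
    by auto
  show ?thesis
  proof (rule shift_continuous_limit[OF _ f lim le])
    fix i
    have fin: "finite (range (s i))"
      using simple_functionD(1)[OF s[of i]] by simp
    have "s i = (\<lambda>x. \<Sum>v\<in>range (s i). v * indicator (s i -` {v}) x)"
      using fin by (auto simp: fun_eq_iff indicator_def if_distrib cong: if_cong)
    moreover have "shift_continuous (\<lambda>x. \<Sum>v\<in>range (s i). v * indicator (s i -` {v}) x)"
      using simple_functionD(2)[OF s[of i], of "{_}"]
      by (intro shift_continuous_sum shift_continuous_scale shift_continuous_indicator)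
        (simp add: sets_eq_borel)
    ultimately show "shift_continuous (s i)" by simp
  qed
qed

lemma l2_norm_shift_tendsto_0:
  assumes "f \<in> L2 M"
  shows "((\<lambda>y. l2_norm M (\<lambda>x. translate y f x - f x)) \<longlongrightarrow> 0) (nhds 0)"
proof -
  have "((\<lambda>y. sqrt (shift_error f y)) \<longlongrightarrow> sqrt 0) (nhds 0)"
    using L2_shift_continuous[OF assms] unfolding shift_continuous_def
    by (intro tendsto_real_sqrt) simp
  then show ?thesis
    by (simp add: l2_norm_def shift_error_def translate_def)
qed

end

section \<open>Characters and averages over finite subgroups\<close>

lemma chr_add_arg: "chr \<xi> (x + y) = chr \<xi> x * chr \<xi> y"
  and norm_chr [simp]: "cmod (chr \<xi> x) = 1"
  and continuous_chr: "continuous_on UNIV (chr \<xi>)"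
  using chr[of \<xi>] by auto

lemma chr_zero [simp]: "chr 0 x = 1"
  by transfer simp

lemma chr_add: "chr (\<xi> + \<eta>) x = chr \<xi> x * chr \<eta> x"
  by transfer simp

lemma chr_uminus: "chr (- \<xi>) x = cnj (chr \<xi> x)"
  by transfer simp

lemma chr_diff: "chr (\<xi> - \<eta>) x = chr \<xi> x * cnj (chr \<eta> x)"
  by (simp only: minus_dual_group_def chr_add chr_uminus)

lemma chr_mult_cnj [simp]: "chr \<xi> x * cnj (chr \<xi> x) = 1" "cnj (chr \<xi> x) * chr \<xi> x = 1"
  using complex_norm_square[of "chr \<xi> x"] by (simp_all add: mult.commute)

lemma chr_nonzero [simp]: "chr \<xi> x \<noteq> 0"
  using norm_chr[of \<xi> x] by force

lemma chr_0_arg [simp]: "chr \<xi> 0 = 1"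
  using chr_add_arg[of \<xi> 0 0] by simp

lemma chr_uminus_arg: "chr \<xi> (- x) = cnj (chr \<xi> x)"
proof -
  have "chr \<xi> (- x) * chr \<xi> x = cnj (chr \<xi> x) * chr \<xi> x"
    by (simp add: chr_add_arg[symmetric])
  then show ?thesis by (simp only: mult_right_cancel[OF chr_nonzero])
qed

lemma chr_diff_arg: "chr \<xi> (x - y) = chr \<xi> x * cnj (chr \<xi> y)"
  using chr_add_arg[of \<xi> x "- y"] by (simp add: chr_uminus_arg)

lemma chr_Abs:
  assumes "continuous_on UNIV f" "\<And>x. cmod (f x) = 1" "\<And>x y. f (x + y) = f x * f y"
  shows "chr (Abs_dual_group f) = f"
  by (rule Abs_dual_group_inverse) (use assms in simp)

definition finite_subgroup :: "'a::ab_group_add set \<Rightarrow> bool"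
  where "finite_subgroup H \<longleftrightarrow> finite H \<and> 0 \<in> H \<and> (\<forall>a\<in>H. \<forall>b\<in>H. a - b \<in> H)"

lemma finite_subgroupD:
  assumes "finite_subgroup H"
  shows "finite H" "0 \<in> H" "\<And>a b. a \<in> H \<Longrightarrow> b \<in> H \<Longrightarrow> a - b \<in> H"
    "\<And>a. a \<in> H \<Longrightarrow> - a \<in> H" "\<And>a b. a \<in> H \<Longrightarrow> b \<in> H \<Longrightarrow> a + b \<in> H" "card H > 0"
proof -
  show *: "finite H" "0 \<in> H" "\<And>a b. a \<in> H \<Longrightarrow> b \<in> H \<Longrightarrow> a - b \<in> H"
    using assms by (auto simp: finite_subgroup_def)
  show neg: "- a \<in> H" if "a \<in> H" for a
    using *(3)[OF *(2) that] by simp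
  show "a + b \<in> H" if "a \<in> H" "b \<in> H" for a b
    using *(3)[OF that(1) neg[OF that(2)]] by simp
  show "card H > 0"
    using * card_gt_0_iff by blast
qed

lemma sum_subgroup_shift:
  assumes "finite_subgroup H" "c \<in> H"
  shows "(\<Sum>a\<in>H. f (a + c)) = (\<Sum>a\<in>H. f a)"
  by (rule sum.reindex_bij_witness[of _ "\<lambda>a. a - c" "\<lambda>a. a + c"])
    (use finite_subgroupD[OF assms(1)] assms(2) in auto)

lemma sum_subgroup_shift_minus:
  assumes "finite_subgroup H" "c \<in> H"
  shows "(\<Sum>a\<in>H. f (a - c)) = (\<Sum>a\<in>H. f a)"
  using sum_subgroup_shift[OF assms(1), of "- c" f] finite_subgroupD(4)[OF assms] by simp

text \<open>For a finite group \<open>H\<close> this orthogonality relation in the second variable of the character table says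
  that the restrictions to \<open>H\<close> of the members of \<open>D\<close> are precisely the characters of \<open>H\<close>, without
  repetition.\<close>

definition complete_characters :: "'a::topological_ab_group_add set \<Rightarrow> 'a dual_group set \<Rightarrow> bool"
  where "complete_characters H D \<longleftrightarrow>
    finite D \<and> (\<forall>c\<in>H. (\<Sum>\<xi>\<in>D. chr \<xi> c) = (if c = 0 then of_nat (card H) else 0))"

text \<open>The projection to the functions on which \<open>H\<close> acts through the character \<open>\<xi>\<close>.\<close>

definition char_average ::
  "'a::topological_ab_group_add set \<Rightarrow> 'a dual_group \<Rightarrow> ('a \<Rightarrow> complex) \<Rightarrow> 'a \<Rightarrow> complex"
  where "char_average H \<xi> f x = (\<Sum>a\<in>H. cnj (chr \<xi> a) * f (x + a)) / of_nat (card H)"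

lemma char_average_shift:
  assumes "finite_subgroup H" "b \<in> H"
  shows "char_average H \<xi> f (x + b) = chr \<xi> b * char_average H \<xi> f x"
proof -
  have "(\<Sum>a\<in>H. cnj (chr \<xi> a) * f (x + b + a)) = (\<Sum>a\<in>H. chr \<xi> b * (cnj (chr \<xi> (a + b)) * f (x + (a + b))))"
    by (intro sum.cong refl) (simp add: chr_add_arg mult.assoc mult.left_commute add_ac)
  also have "\<dots> = (\<Sum>a\<in>H. chr \<xi> b * (cnj (chr \<xi> a) * f (x + a)))"
    by (rule sum_subgroup_shift[OF assms])
  finally show ?thesis
    by (simp add: char_average_def sum_distrib_left)
qed

lemma sum_char_average:
  assumes H: "finite_subgroup H" and D: "complete_characters H D"
  shows "(\<Sum>\<xi>\<in>D. char_average H \<xi> f 0) = f 0"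
proof -
  have "(\<Sum>\<xi>\<in>D. \<Sum>a\<in>H. cnj (chr \<xi> a) * f a) = (\<Sum>a\<in>H. cnj (\<Sum>\<xi>\<in>D. chr \<xi> a) * f a)"
    by (subst sum.swap) (simp add: sum_distrib_right)
  also have "\<dots> = (\<Sum>a\<in>H. if a = 0 then of_nat (card H) * f a else 0)"
    using D by (intro sum.cong) (auto simp: complete_characters_def)
  also have "\<dots> = of_nat (card H) * f 0"
    using finite_subgroupD[OF H] by simp
  finally show ?thesis
    using finite_subgroupD(6)[OF H]
    by (simp add: char_average_def sum_divide_distrib[symmetric])
qed

lemma parseval_char_average:
  assumes H: "finite_subgroup H" and D: "complete_characters H D"
  shows "(\<Sum>\<xi>\<in>D. (cmod (char_average H \<xi> f 0))\<^sup>2) = (\<Sum>a\<in>H. (cmod (f a))\<^sup>2) / card H"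
proof -
  let ?N = "of_nat (card H) :: complex"
  have N: "?N \<noteq> 0" using finite_subgroupD(6)[OF H] by simp
  have "of_real (\<Sum>\<xi>\<in>D. (cmod (char_average H \<xi> f 0))\<^sup>2)
      = (\<Sum>\<xi>\<in>D. char_average H \<xi> f 0 * cnj (char_average H \<xi> f 0))"
    by (simp only: of_real_sum complex_norm_square)
  also have "\<dots> = (\<Sum>\<xi>\<in>D. (\<Sum>a\<in>H. \<Sum>b\<in>H. cnj (chr \<xi> a) * f a * (chr \<xi> b * cnj (f b)))) / ?N\<^sup>2"
    by (simp add: char_average_def sum_divide_distrib power2_eq_square sum_product)
  also have "(\<Sum>\<xi>\<in>D. (\<Sum>a\<in>H. \<Sum>b\<in>H. cnj (chr \<xi> a) * f a * (chr \<xi> b * cnj (f b))))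
      = (\<Sum>\<xi>\<in>D. \<Sum>a\<in>H. \<Sum>b\<in>H. f a * cnj (f b) * chr \<xi> (b - a))"
    by (intro sum.cong refl) (simp add: chr_diff_arg mult_ac)
  also have "\<dots> = (\<Sum>a\<in>H. \<Sum>b\<in>H. f a * cnj (f b) * (\<Sum>\<xi>\<in>D. chr \<xi> (b - a)))"
    by (subst sum.swap, rule sum.cong[OF refl], subst sum.swap) (simp add: sum_distrib_left)
  also have "\<dots> = (\<Sum>a\<in>H. \<Sum>b\<in>H. if b = a then f a * cnj (f a) * ?N else 0)"
    using D finite_subgroupD(3)[OF H] by (intro sum.cong refl) (auto simp: complete_characters_def)
  also have "\<dots> = (\<Sum>a\<in>H. f a * cnj (f a) * ?N)"
    using finite_subgroupD(1)[OF H] by simp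
  also have "\<dots> = of_real (\<Sum>a\<in>H. (cmod (f a))\<^sup>2) * ?N"
    by (simp only: of_real_sum complex_norm_square sum_distrib_right)
  also have "\<dots> / ?N\<^sup>2 = of_real ((\<Sum>a\<in>H. (cmod (f a))\<^sup>2) / card H)"
    using N by (simp add: power2_eq_square)
  finally show ?thesis by (simp only: of_real_eq_iff)
qed

lemma norm_char_average_le:
  assumes H: "finite_subgroup H" and le: "\<And>a. a \<in> H \<Longrightarrow> cmod (f (x + a)) \<le> B"
  shows "cmod (char_average H \<xi> f x) \<le> B"
proof -
  have "cmod (\<Sum>a\<in>H. cnj (chr \<xi> a) * f (x + a)) \<le> of_nat (card H) * B"
    by (rule sum_norm_bound) (use le in \<open>simp add: norm_mult\<close>)
  then show ?thesis
    using finite_subgroupD(6)[OF H] by (simp add: char_average_def norm_divide divide_le_eq mult.commute)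
qed

lemma char_average_diff:
  "char_average H \<xi> f x - char_average H \<xi> f y = char_average H \<xi> (\<lambda>z. f (x + z) - f (y + z)) 0"
  by (simp add: char_average_def diff_divide_distrib[symmetric] sum_subtractf[symmetric]
      right_diff_distrib)

context second_countable_haar
begin

text \<open>The convolution of \<open>g\<close> with its reflected conjugate: a continuous positive definite function whose
  Fourier coefficients are the squared moduli of those of \<open>g\<close>.\<close>

definition autocorrelation :: "('a \<Rightarrow> complex) \<Rightarrow> 'a \<Rightarrow> complex"
  where "autocorrelation g x = l2_inner M (translate (- x) g) g"

lemma fourier_translate:
  assumes "f \<in> L2 M"
  shows "fourier M (translate a f) \<xi> = cnj (chr \<xi> a) * fourier M f \<xi>"
proof -
  have [measurable]: "(\<lambda>x. cnj (chr \<xi> x)) \<in> borel_measurable M"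
    using borel_measurable_continuous_onI[OF continuous_on_cnj[OF continuous_chr[of \<xi>]]]
    by (simp add: measurable_cong_sets[OF sets_eq_borel refl])
  note [measurable] = L2_measurable[OF assms]
  have "fourier M (translate a f) \<xi> = (LINT x|M. f (x - a) * cnj (chr \<xi> ((x - a) + a)))"
    by (simp add: fourier_def translate_def)
  also have "\<dots> = (LINT x|M. f x * cnj (chr \<xi> (x + a)))"
    by (rule integral_minus[where f = "\<lambda>x. f x * cnj (chr \<xi> (x + a))"])
      (simp add: chr_add_arg)
  also have "\<dots> = (LINT x|M. cnj (chr \<xi> a) * (f x * cnj (chr \<xi> x)))"
    by (rule Bochner_Integration.integral_cong) (simp_all add: chr_add_arg mult_ac)
  also have "\<dots> = cnj (chr \<xi> a) * fourier M f \<xi>"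
    by (simp add: fourier_def)
  finally show ?thesis .
qed

lemma chr_L2: "chr \<xi> \<in> L2 M"
  by (rule L2_bounded[where c = 1])
    (use borel_measurable_continuous_onI[OF continuous_chr[of \<xi>]]
      in \<open>auto simp: measurable_cong_sets[OF sets_eq_borel refl]\<close>)

lemma fourier_inner: "fourier M f \<xi> = l2_inner M f (chr \<xi>)"
  by (simp add: fourier_def l2_inner_def)

lemma continuous_measurable: "continuous_on UNIV f \<Longrightarrow> f \<in> borel_measurable M"
  using borel_measurable_continuous_onI[of f] by (simp add: measurable_cong_sets[OF sets_eq_borel refl])

context
  fixes g
  assumes g: "g \<in> L2 M"
begin

lemma autocorrelation_0: "autocorrelation g 0 = of_real ((l2_norm M g)\<^sup>2)"
  by (simp add: autocorrelation_def translate_def inner_self l2_norm_sq)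

lemma autocorrelation_le: "cmod (autocorrelation g x) \<le> (l2_norm M g)\<^sup>2"
  using cauchy_schwarz[OF L2_translate[OF g, of "- x"] g]
  by (simp add: autocorrelation_def l2_norm_translate[OF g] power2_eq_square)

text \<open>A modulus of continuity for the autocorrelation, inherited by all its averages; this is the source of
  equicontinuity below.\<close>

definition modulus :: "'a \<Rightarrow> real"
  where "modulus y = l2_norm M (\<lambda>x. translate y g x - g x) * l2_norm M g"

lemma modulus_tendsto_0: "(modulus \<longlongrightarrow> 0) (nhds 0)"
  unfolding modulus_def[abs_def] by (intro tendsto_mult_left_zero l2_norm_shift_tendsto_0 g)

lemma autocorrelation_diff_le:
  "cmod (autocorrelation g x - autocorrelation g y) \<le> modulus (y - x)"
proof -
  have d: "(\<lambda>z. translate (y - x) g z - g z) \<in> L2 M"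
    by (intro L2_diff L2_translate g)
  have "autocorrelation g x - autocorrelation g y
      = l2_inner M (\<lambda>z. translate (- x) g z - translate (- y) g z) g"
    unfolding autocorrelation_def by (rule inner_diff_left[symmetric]) (intro L2_translate g)+
  also have "(\<lambda>z. translate (- x) g z - translate (- y) g z)
      = translate (- y) (\<lambda>z. translate (y - x) g z - g z)"
    by (auto simp: translate_def algebra_simps)
  finally show ?thesis
    using cauchy_schwarz[OF L2_translate[OF d, of "- y"] g] l2_norm_translate[OF d, of "- y"]
    by (simp add: modulus_def)
qed

lemma continuous_if_modulus:
  assumes "\<And>x y. cmod (F x - F y) \<le> modulus (y - x)"
  shows "continuous_on UNIV F"
  unfolding continuous_on_def
proof
  fix y
  have "((\<lambda>x. modulus (y - x)) \<longlongrightarrow> 0) (at y)"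
  proof (rule filterlim_compose[OF modulus_tendsto_0])
    have "((\<lambda>x. y - x) \<longlongrightarrow> y - y) (at y)" by (intro tendsto_intros)
    then show "((\<lambda>x. y - x) \<longlongrightarrow> 0) (at y)" by simp
  qed
  then have "((\<lambda>x. F x - F y) \<longlongrightarrow> 0) (at y)"
    by (rule Lim_null_comparison[rotated]) (use assms in simp)
  then show "(F \<longlongrightarrow> F y) (at y within UNIV)"
    by (simp add: LIM_zero_iff)
qed

lemma continuous_autocorrelation: "continuous_on UNIV (autocorrelation g)"
  by (rule continuous_if_modulus) (rule autocorrelation_diff_le)

lemma autocorrelation_L2: "autocorrelation g \<in> L2 M"
  by (rule L2_bounded[OF continuous_measurable[OF continuous_autocorrelation] autocorrelation_le])

text \<open>Positive definiteness on \<open>H\<close>: up to the factor \<open>card H * card H\<close> the average is the squared norm of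
  the \<open>\<xi>\<close>-component of \<open>g\<close>.\<close>

lemma char_average_autocorrelation:
  assumes H: "finite_subgroup H"
  obtains c :: real where "c \<ge> 0" "char_average H \<xi> (autocorrelation g) 0 = of_real c"
proof -
  let ?N = "of_nat (card H) :: complex"
  have N: "?N \<noteq> 0" using finite_subgroupD(6)[OF H] by simp
  define P where "P = (\<lambda>y. \<Sum>a\<in>H. cnj (chr \<xi> a) * translate (- a) g y)"
  note gL = L2_translate[OF g]
  have PL: "P \<in> L2 M"
    unfolding P_def by (intro L2_sum L2_scale gL)
  have "l2_inner M P P = (\<Sum>a\<in>H. cnj (chr \<xi> a) * l2_inner M (translate (- a) g) P)"
    by (subst (1) P_def, subst inner_sum_left) (use gL PL in auto)
  also have "\<dots> = (\<Sum>a\<in>H. cnj (chr \<xi> a) * (\<Sum>b\<in>H. chr \<xi> b * l2_inner M (translate (- a) g) (translate (- b) g)))"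
    unfolding P_def by (subst inner_sum_right) (use gL in auto)
  also have "\<dots> = (\<Sum>a\<in>H. \<Sum>b\<in>H. cnj (chr \<xi> (a - b)) * autocorrelation g (a - b))"
    by (simp add: inner_translate[OF g g] autocorrelation_def sum_distrib_left chr_diff_arg mult_ac)
  also have "\<dots> = (\<Sum>b\<in>H. \<Sum>a\<in>H. cnj (chr \<xi> a) * autocorrelation g a)"
    by (subst sum.swap, rule sum.cong[OF refl])
      (rule sum_subgroup_shift_minus[OF H, where f = "\<lambda>a. cnj (chr \<xi> a) * autocorrelation g a"])
  also have "\<dots> = ?N * (?N * char_average H \<xi> (autocorrelation g) 0)"
    using N by (simp add: char_average_def)
  finally have "char_average H \<xi> (autocorrelation g) 0 = l2_inner M P P / (?N * ?N)"
    using N by (simp add: field_simps)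
  also have "\<dots> = of_real ((LINT x|M. (cmod (P x))\<^sup>2) / (card H * card H))"
    by (simp add: inner_self)
  finally show ?thesis
    by (intro that[of "(LINT x|M. (cmod (P x))\<^sup>2) / (card H * card H)"]) simp_all
qed

text \<open>By Fubini's theorem the inner product is the product of the Fourier coefficient of \<open>g\<close> with its conjugate.\<close>

lemma inner_autocorrelation_chr:
  assumes 0: "fourier M g \<xi> = 0"
  shows "l2_inner M (autocorrelation g) (chr \<xi>) = 0"
proof -
  interpret P: pair_prob_space M M ..
  note [measurable] = L2_measurable[OF g]
  define F where "F = (\<lambda>(x, y). g (y + x) * cnj (g y) * cnj (chr \<xi> x))"
  have cnj_meas: "(cnj :: complex \<Rightarrow> complex) \<in> borel_measurable borel"
    by (intro borel_measurable_continuous_onI continuous_intros)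
  have "(\<lambda>p::'a \<times> 'a. snd p + fst p) \<in> borel_measurable borel"
    by (intro borel_measurable_continuous_onI continuous_intros)
  moreover have "sets (M \<Otimes>\<^sub>M M) = sets (borel :: ('a \<times> 'a) measure)"
    by (simp add: borel_prod[symmetric] sets_pair_measure_cong[OF sets_eq_borel sets_eq_borel])
  ultimately have plus: "(\<lambda>p. snd p + fst p) \<in> measurable (M \<Otimes>\<^sub>M M) M"
    by (simp add: measurable_cong_sets[OF _ sets_eq_borel] cong: measurable_cong_sets)
  have "F \<in> borel_measurable (M \<Otimes>\<^sub>M M)"
    unfolding F_def case_prod_beta
  proof (intro borel_measurable_times)
    show "(\<lambda>p. g (snd p + fst p)) \<in> borel_measurable (M \<Otimes>\<^sub>M M)"
      by (rule measurable_compose[OF plus]) measurable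
    show "(\<lambda>p. cnj (g (snd p))) \<in> borel_measurable (M \<Otimes>\<^sub>M M)"
      by (rule measurable_compose[OF _ cnj_meas]) measurable
    show "(\<lambda>p. cnj (chr \<xi> (fst p))) \<in> borel_measurable (M \<Otimes>\<^sub>M M)"
      by (rule measurable_compose[OF measurable_compose[OF measurable_fst L2_measurable[OF chr_L2]] cnj_meas])
  qed
  note [measurable] = this
  have int_x: "integrable M (\<lambda>y. F (x, y))" for x
    using L2_prod_integrable[OF L2_translate[OF g, of "- x"] g]
    by (simp add: F_def translate_def)
  have "integrable (M \<Otimes>\<^sub>M M) F"
  proof (rule P.Fubini_integrable)
    show "integrable M (\<lambda>x. LINT y|M. norm (F (x, y)))"
    proof (rule integrable_const_bound)
      show "AE x in M. norm (LINT y|M. norm (F (x, y))) \<le> (l2_norm M g)\<^sup>2"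
      proof (rule AE_I2)
        fix x
        have n: "(\<lambda>x. of_real (cmod (h x))) \<in> L2 M" if "h \<in> L2 M" for h
          by (rule L2_dominated[OF _ that, where c = 1]) (use L2_measurable[OF that] in auto)
        have "of_real (LINT y|M. norm (F (x, y)))
          = l2_inner M (\<lambda>y. of_real (cmod (translate (- x) g y))) (\<lambda>y. of_real (cmod (g y)))"
          unfolding l2_inner_def integral_complex_of_real[symmetric]
          by (rule Bochner_Integration.integral_cong) (simp_all add: F_def translate_def norm_mult)
        then have "norm (LINT y|M. norm (F (x, y)))
          = cmod (l2_inner M (\<lambda>y. of_real (cmod (translate (- x) g y))) (\<lambda>y. of_real (cmod (g y))))"
          by (metis norm_of_real real_norm_def)
        also have "\<dots> \<le> l2_norm M (\<lambda>y. of_real (cmod (translate (- x) g y))) * l2_norm M (\<lambda>y. of_real (cmod (g y)))"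
          by (intro cauchy_schwarz n L2_translate g)
        also have "\<dots> = l2_norm M (translate (- x) g) * l2_norm M g"
          by (simp add: l2_norm_def)
        finally show "norm (LINT y|M. norm (F (x, y))) \<le> (l2_norm M g)\<^sup>2"
          by (simp add: l2_norm_translate[OF g] power2_eq_square)
      qed
    qed measurable
    show "AE x in M. integrable M (\<lambda>y. F (x, y))"
      by (rule AE_I2) (rule int_x)
  qed measurable
  then have "(LINT y|M. LINT x|M. F (x, y)) = (LINT x|M. LINT y|M. F (x, y))"
    using P.Fubini_integral[of "\<lambda>x y. F (x, y)"] by simp
  moreover have "(LINT y|M. F (x, y)) = autocorrelation g x * cnj (chr \<xi> x)" for x
    by (simp add: F_def autocorrelation_def l2_inner_def translate_def)
  moreover have "(LINT x|M. F (x, y)) = cnj (g y) * fourier M (translate (- y) g) \<xi>" for y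
  proof -
    have "F (x, y) = cnj (g y) * (g (y + x) * cnj (chr \<xi> x))" for x
      by (simp add: F_def mult_ac)
    then show ?thesis by (simp add: fourier_def translate_def add.commute)
  qed
  ultimately have "l2_inner M (autocorrelation g) (chr \<xi>)
      = (LINT y|M. cnj (g y) * fourier M (translate (- y) g) \<xi>)"
    by (simp add: l2_inner_def)
  also have "\<dots> = 0"
    by (simp add: fourier_translate[OF g] 0)
  finally show ?thesis .
qed

end

text \<open>The average over \<open>H\<close> is an orthogonal projection.\<close>

lemma inner_char_average:
  assumes H: "finite_subgroup H" and k: "k \<in> L2 M"
  shows "l2_inner M k (char_average H \<xi> k)
    = l2_inner M (char_average H \<xi> k) (char_average H \<xi> k)"
proof -
  let ?N = "of_nat (card H) :: complex" and ?K = "char_average H \<xi> k"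
  have N: "?N \<noteq> 0" using finite_subgroupD(6)[OF H] by simp
  have K: "?K = (\<lambda>x. \<Sum>a\<in>H. cnj (chr \<xi> a) / ?N * translate (- a) k x)"
    by (auto simp: char_average_def translate_def sum_divide_distrib)
  have KL: "?K \<in> L2 M"
    unfolding K by (intro L2_sum L2_scale L2_translate k)
  have *: "l2_inner M k ?K = cnj (chr \<xi> a) * l2_inner M (translate (- a) k) ?K" if "a \<in> H" for a
  proof -
    have "l2_inner M k ?K = l2_inner M (translate (- a) k) (translate (- a) ?K)"
      using inner_translate[OF k KL, of "- a" "- a"] by (simp add: translate_def[of 0])
    also have "translate (- a) ?K = (\<lambda>x. chr \<xi> a * ?K x)"
      using char_average_shift[OF H that] by (simp add: translate_def fun_eq_iff)
    finally show ?thesis by (simp add: inner_scale_right)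
  qed
  have "l2_inner M ?K ?K = (\<Sum>a\<in>H. cnj (chr \<xi> a) / ?N * l2_inner M (translate (- a) k) ?K)"
    by (subst (1) K, subst inner_sum_left) (use k KL in \<open>auto intro: L2_translate\<close>)
  also have "\<dots> = (\<Sum>a\<in>H. l2_inner M k ?K / ?N)"
    by (intro sum.cong refl) (simp add: *[symmetric])
  also have "\<dots> = l2_inner M k ?K" using N by simp
  finally show ?thesis ..
qed

end

section \<open>Uniqueness of Fourier coefficients\<close>

locale dense_finite_subgroups = second_countable_haar M
  for M :: "'a::{topological_ab_group_add, second_countable_topology} measure" +
  fixes H :: "nat \<Rightarrow> 'a set" and D :: "nat \<Rightarrow> 'a dual_group set"
  assumes compact_UNIV: "compact (UNIV :: 'a set)"
    and subgroup: "finite_subgroup (H j)"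
    and mono_H: "mono H"
    and dense: "closure (\<Union>j. H j) = UNIV"
    and complete: "complete_characters (H j) (D j)"
begin

lemma dense_meets:
  assumes "open W" "x \<in> W"
  obtains h where "h \<in> (\<Union>j. H j)" "h \<in> W"
  using open_Int_closure_eq_empty[OF assms(1), of "\<Union>j. H j"] dense assms(2) by auto

text \<open>By density and compactness finitely many translates of \<open>U\<close> by elements of the subgroups cover the group.
  Once \<open>H j\<close> contains these elements, it is covered by that many translates of \<open>H j \<inter> U\<close>.\<close>

lemma subgroup_meets_nhd:
  assumes U: "open U" "0 \<in> U"
  obtains n :: nat and i where "\<And>j. i \<le> j \<Longrightarrow> card (H j) \<le> n * card (H j \<inter> U)"
proof -
  have "UNIV \<subseteq> (\<Union>h\<in>(\<Union>j. H j). (\<lambda>x. x - h) -` U)"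
  proof
    fix x :: 'a
    have "open ((\<lambda>h. x - h) -` U)" "x \<in> (\<lambda>h. x - h) -` U"
      using U by (auto intro!: open_vimage continuous_intros)
    then obtain h where "h \<in> (\<Union>j. H j)" "h \<in> (\<lambda>h. x - h) -` U"
      by (rule dense_meets)
    then show "x \<in> (\<Union>h\<in>(\<Union>j. H j). (\<lambda>x. x - h) -` U)" by blast
  qed
  then obtain F where F: "F \<subseteq> (\<Union>j. H j)" "finite F" "UNIV \<subseteq> (\<Union>h\<in>F. (\<lambda>x. x - h) -` U)"
    by (rule compactE_image[OF compact_UNIV, rotated])
      (use U in \<open>auto intro!: open_vimage continuous_intros\<close>)
  have "\<exists>i. F \<subseteq> H i"
    using F(2,1)
  proof (induction F rule: finite_induct)
    case (insert h F)
    then obtain i i' where "F \<subseteq> H i" "h \<in> H i'" by auto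
    then have "insert h F \<subseteq> H (max i i')"
      using monoD[OF mono_H, of i "max i i'"] monoD[OF mono_H, of i' "max i i'"] by auto
    then show ?case ..
  qed auto
  then obtain i where i: "F \<subseteq> H i" ..
  have "card (H j) \<le> card F * card (H j \<inter> U)" if j: "i \<le> j" for j
  proof -
    note Hj = finite_subgroupD[OF subgroup[of j]]
    have FH: "F \<subseteq> H j" using i monoD[OF mono_H j] by auto
    have "H j \<subseteq> (\<Union>h\<in>F. (\<lambda>x. x + h) ` (H j \<inter> U))"
    proof
      fix x assume x: "x \<in> H j"
      from F(3) obtain h where "h \<in> F" "x - h \<in> U" by auto
      then show "x \<in> (\<Union>h\<in>F. (\<lambda>x. x + h) ` (H j \<inter> U))"
        using x FH Hj(3)[of x h] by (auto intro!: bexI[of _ h] image_eqI[of _ _ "x - h"])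
    qed
    then have "card (H j) \<le> card (\<Union>h\<in>F. (\<lambda>x. x + h) ` (H j \<inter> U))"
      using F(2) Hj(1) by (intro card_mono) auto
    also have "\<dots> \<le> (\<Sum>h\<in>F. card ((\<lambda>x. x + h) ` (H j \<inter> U)))"
      by (rule card_UN_le[OF F(2)])
    also have "\<dots> \<le> (\<Sum>h\<in>F. card (H j \<inter> U))"
      using Hj(1) by (intro sum_mono card_image_le) auto
    finally show ?thesis by simp
  qed
  then show ?thesis by (rule that)
qed

text \<open>The averages \<open>c\<close> of the autocorrelation \<open>k\<close> against the characters of \<open>H j\<close> are nonnegative with sum
  \<open>k 0\<close>, while the sum of their squares is the mean of \<open>(cmod k)\<^sup>2\<close> over \<open>H j\<close>. The latter is bounded below
  because \<open>H j\<close> visits the neighbourhood where \<open>cmod k > k 0 / 2\<close> often enough; so the largest \<open>c\<close>, being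
  at least the quotient of the two sums, cannot tend to \<open>0\<close>.\<close>

lemma large_char_average:
  assumes g: "g \<in> L2 M" and g0: "l2_norm M g \<noteq> 0"
  obtains \<delta> :: real and i :: nat and \<gamma> :: "nat \<Rightarrow> 'a dual_group"
  where "\<delta> > 0" "\<And>j. i \<le> j \<Longrightarrow> \<delta> \<le> cmod (char_average (H j) (\<gamma> j) (autocorrelation g) 0)"
proof -
  define k where "k = autocorrelation g"
  define E where "E = (l2_norm M g)\<^sup>2"
  have E: "E > 0" using g0 by (simp add: E_def)
  have k0: "k 0 = of_real E" unfolding k_def E_def by (rule autocorrelation_0[OF g])
  define U where "U = {x. E / 2 < cmod (k x)}"
  have "open U"
    unfolding U_def k_def
    by (intro open_Collect_less continuous_intros continuous_autocorrelation[OF g])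
  moreover have "0 \<in> U" using E by (simp add: U_def k0)
  ultimately obtain n i where n: "\<And>j. i \<le> j \<Longrightarrow> card (H j) \<le> n * card (H j \<inter> U)"
    by (rule subgroup_meets_nhd) (rule that)
  have "n > 0"
    using n[of i] finite_subgroupD(6)[OF subgroup[of i]] by (cases n) auto
  \<comment> \<open>The mean of \<open>(cmod k)\<^sup>2\<close> is at least \<open>E\<^sup>2 / (4 * n)\<close>, so \<open>E / (4 * n)\<close> would do; half of it makes the contradiction strict.\<close>
  define \<delta> where "\<delta> = E / (8 * real n)"
  have \<delta>: "\<delta> > 0" using E \<open>n > 0\<close> by (simp add: \<delta>_def)
  have "\<exists>\<gamma>. \<delta> \<le> cmod (char_average (H j) \<gamma> k 0)" if j: "i \<le> j" for j
  proof (rule ccontr)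
    assume "\<not> ?thesis"
    then have less: "cmod (char_average (H j) \<xi> k 0) \<le> \<delta>" for \<xi>
      by (auto simp: not_le intro: less_imp_le)
    note Hj = finite_subgroupD[OF subgroup[of j]]
    have "of_real (cmod (char_average (H j) \<xi> k 0)) = char_average (H j) \<xi> k 0" for \<xi>
    proof -
      obtain c where "c \<ge> 0" "char_average (H j) \<xi> k 0 = of_real c"
        unfolding k_def by (rule char_average_autocorrelation[OF g subgroup])
      then show ?thesis by simp
    qed
    then have "of_real (\<Sum>\<xi>\<in>D j. cmod (char_average (H j) \<xi> k 0)) = k 0"
      using sum_char_average[OF subgroup complete, of j k] by simp
    then have sum_eq: "(\<Sum>\<xi>\<in>D j. cmod (char_average (H j) \<xi> k 0)) = E"
      by (simp only: k0 of_real_eq_iff)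
    have "(\<Sum>\<xi>\<in>D j. (cmod (char_average (H j) \<xi> k 0))\<^sup>2)
        \<le> (\<Sum>\<xi>\<in>D j. \<delta> * cmod (char_average (H j) \<xi> k 0))"
      unfolding power2_eq_square by (intro sum_mono mult_right_mono less) simp
    also have "\<dots> = \<delta> * E"
      by (simp add: sum_distrib_left[symmetric] sum_eq)
    finally have sq_le: "(\<Sum>\<xi>\<in>D j. (cmod (char_average (H j) \<xi> k 0))\<^sup>2) \<le> \<delta> * E" .
    have "(E / 2)\<^sup>2 * real (card (H j \<inter> U)) = (\<Sum>a\<in>H j \<inter> U. (E / 2)\<^sup>2)" by simp
    also have "\<dots> \<le> (\<Sum>a\<in>H j \<inter> U. (cmod (k a))\<^sup>2)"
      using E by (intro sum_mono power_mono) (auto simp: U_def)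
    also have "\<dots> \<le> (\<Sum>a\<in>H j. (cmod (k a))\<^sup>2)"
      using Hj(1) by (intro sum_mono2) auto
    also have "\<dots> = real (card (H j)) * (\<Sum>\<xi>\<in>D j. (cmod (char_average (H j) \<xi> k 0))\<^sup>2)"
      using Hj(6) by (simp add: parseval_char_average[OF subgroup complete])
    also have "\<dots> \<le> real (card (H j)) * (\<delta> * E)"
      by (intro mult_left_mono sq_le) simp
    also have "real (card (H j)) * (\<delta> * E) \<le> real (n * card (H j \<inter> U)) * (\<delta> * E)"
      using n[OF j] \<delta> E by (intro mult_right_mono) (simp_all only: of_nat_le_iff, simp)
    also have "\<dots> = (E\<^sup>2 / 8) * real (card (H j \<inter> U))"
      using \<open>n > 0\<close> by (simp add: \<delta>_def power2_eq_square)
    finally have "(E / 2)\<^sup>2 * real (card (H j \<inter> U)) \<le> (E\<^sup>2 / 8) * real (card (H j \<inter> U))" .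
    moreover have "card (H j \<inter> U) > 0"
      using n[OF j] Hj(6) by (cases "card (H j \<inter> U)") auto
    ultimately have "(E / 2)\<^sup>2 \<le> E\<^sup>2 / 8" by simp
    then show False using E by (simp add: power2_eq_square)
  qed
  then obtain \<gamma> where "\<And>j. i \<le> j \<Longrightarrow> \<delta> \<le> cmod (char_average (H j) (\<gamma> j) k 0)"
    by metis
  with \<delta> show ?thesis unfolding k_def by (rule that)
qed

text \<open>A limit of the averages \<open>K j\<close> along \<open>H j\<close> is multiplicative up to a constant, because each \<open>K j\<close> is
  multiplicative for shifts in \<open>H j\<close> and these subgroups exhaust a dense set. The identity
  \<open>\<langle>k, K j\<rangle> = \<langle>K j, K j\<rangle>\<close> survives in the limit and shows that the limiting character is a frequency
  of \<open>k\<close>.\<close>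

theorem fourier_eq_0_imp_AE:
  assumes g: "g \<in> L2 M" and fourier_0: "\<And>\<xi>. fourier M g \<xi> = 0"
  shows "AE x in M. g x = 0"
proof (rule l2_norm_eq_0_imp_AE[OF g], rule ccontr)
  assume "l2_norm M g \<noteq> 0"
  then obtain \<delta> i \<gamma> where \<delta>: "\<delta> > 0"
    and large: "\<And>j. i \<le> j \<Longrightarrow> \<delta> \<le> cmod (char_average (H j) (\<gamma> j) (autocorrelation g) 0)"
    using large_char_average[OF g] by metis
  define k where "k = autocorrelation g"
  define K where "K j = char_average (H (i + j)) (\<gamma> (i + j)) k" for j
  define B where "B = (l2_norm M g)\<^sup>2"
  have K_bound: "cmod (K j x) \<le> B" for j x
    unfolding K_def B_def k_def
    by (intro norm_char_average_le subgroup autocorrelation_le g)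
  have K_diff: "cmod (K j x - K j y) \<le> modulus g (y - x)" for j x y
    unfolding K_def char_average_diff
  proof (rule norm_char_average_le[OF subgroup])
    show "cmod (k (x + (0 + a)) - k (y + (0 + a))) \<le> modulus g (y - x)" for a
      using autocorrelation_diff_le[OF g, of "x + a" "y + a"] by (simp add: k_def)
  qed
  have K_shift: "K j (x + a) = chr (\<gamma> (i + j)) a * K j x" if "a \<in> H (i + j)" for j x a
    unfolding K_def by (rule char_average_shift[OF subgroup that])
  \<comment> \<open>Pointwise convergence is arranged on the dense countable union first; equicontinuity extends it to the whole group.\<close>
  have "countable (\<Union>j. H j)"
    using finite_subgroupD(1)[OF subgroup] by (auto intro: countable_finite)
  then obtain r :: "nat \<Rightarrow> nat" where r: "strict_mono r"
    and conv_H: "\<And>x. x \<in> (\<Union>j. H j) \<Longrightarrow> \<exists>l. (\<lambda>n. K (r n) x) \<longlonglongrightarrow> l"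
    using function_convergent_subsequence[of "\<Union>j. H j" K B] K_bound by blast
  have "convergent (\<lambda>n. K (r n) x)" for x
  proof (rule Cauchy_convergent, rule metric_CauchyI)
    fix e :: real assume e: "e > 0"
    have "((\<lambda>y. modulus g (y - x)) \<longlongrightarrow> 0) (nhds x)"
    proof (rule filterlim_compose[OF modulus_tendsto_0[OF g]])
      have "((\<lambda>y. y - x) \<longlongrightarrow> x - x) (nhds x)"
        by (intro tendsto_diff filterlim_ident tendsto_const)
      then show "((\<lambda>y. y - x) \<longlongrightarrow> 0) (nhds x)" by simp
    qed
    from order_tendstoD(2)[OF this, of "e / 3"] e
    obtain W where W: "open W" "x \<in> W" "\<And>y. y \<in> W \<Longrightarrow> modulus g (y - x) < e / 3"
      by (auto simp: eventually_nhds)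
    obtain y where y: "y \<in> (\<Union>j. H j)" "y \<in> W"
      using W(1,2) by (rule dense_meets)
    note y_less = W(3)[OF y(2)]
    from conv_H[OF y(1)] have "Cauchy (\<lambda>n. K (r n) y)"
      by (auto simp: Cauchy_convergent_iff convergent_def)
    then obtain N where N: "\<And>m n. N \<le> m \<Longrightarrow> N \<le> n \<Longrightarrow> dist (K (r m) y) (K (r n) y) < e / 3"
      using e metric_CauchyD[of "\<lambda>n. K (r n) y" "e / 3"] by auto
    have "dist (K (r m) x) (K (r n) x) < e" if "N \<le> m" "N \<le> n" for m n
    proof -
      have "dist (K (r m) x) (K (r n) x)
          \<le> dist (K (r m) x) (K (r m) y) + dist (K (r m) y) (K (r n) y) + dist (K (r n) x) (K (r n) y)"
        using dist_triangle[of "K (r m) x" "K (r n) x" "K (r m) y"]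
          dist_triangle[of "K (r m) y" "K (r n) x" "K (r n) y"]
        by (simp add: dist_commute)
      then show ?thesis
        using N[OF that] K_diff[of "r m" x y] K_diff[of "r n" x y] y_less by (simp add: dist_norm)
    qed
    then show "\<exists>N. \<forall>m\<ge>N. \<forall>n\<ge>N. dist (K (r m) x) (K (r n) x) < e" by blast
  qed
  then obtain L where L: "\<And>x. (\<lambda>n. K (r n) x) \<longlonglongrightarrow> L x"
    unfolding convergent_def by metis
  have L_diff: "cmod (L x - L y) \<le> modulus g (y - x)" for x y
    by (rule tendsto_le[OF _ tendsto_const tendsto_norm[OF tendsto_diff[OF L L]]])
      (use K_diff in auto)
  have L_cont: "continuous_on UNIV L"
    by (rule continuous_if_modulus[OF g L_diff])
  have "\<delta> \<le> cmod (L 0)"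
    by (rule tendsto_le[OF _ tendsto_norm[OF L] tendsto_const])
      (use large in \<open>auto simp: K_def k_def\<close>)
  with \<delta> have L0: "L 0 \<noteq> 0" by auto
  have eventually_H: "\<forall>\<^sub>F n in sequentially. a \<in> H (i + r n)" if "a \<in> (\<Union>j. H j)" for a
  proof -
    from that obtain j where "a \<in> H j" by auto
    moreover have "H j \<subseteq> H (i + r n)" if "j \<le> n" for n
      using strict_mono_imp_increasing[OF r, of n] that by (intro monoD[OF mono_H]) simp
    ultimately show ?thesis
      unfolding eventually_sequentially by blast
  qed
  have mult_H: "L (x + a) * L 0 = L x * L a" if a: "a \<in> (\<Union>j. H j)" for x a
  proof (rule LIMSEQ_unique)
    show "(\<lambda>n. K (r n) x * K (r n) a) \<longlonglongrightarrow> L x * L a"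
      by (intro tendsto_mult L)
    have "(\<lambda>n. K (r n) (x + a) * K (r n) 0) \<longlonglongrightarrow> L (x + a) * L 0"
      by (intro tendsto_mult L)
    moreover have "\<forall>\<^sub>F n in sequentially. K (r n) (x + a) * K (r n) 0 = K (r n) x * K (r n) a"
      using eventually_H[OF a]
      by eventually_elim (use K_shift[of a _ 0] in \<open>simp add: K_shift\<close>)
    ultimately show "(\<lambda>n. K (r n) x * K (r n) a) \<longlonglongrightarrow> L (x + a) * L 0"
      by (rule Lim_transform_eventually)
  qed
  have norm_H: "cmod (L a) = cmod (L 0)" if a: "a \<in> (\<Union>j. H j)" for a
  proof (rule LIMSEQ_unique)
    show "(\<lambda>n. cmod (K (r n) 0)) \<longlonglongrightarrow> cmod (L 0)"
      by (intro tendsto_norm L)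
    have "(\<lambda>n. cmod (K (r n) a)) \<longlonglongrightarrow> cmod (L a)"
      by (intro tendsto_norm L)
    moreover have "\<forall>\<^sub>F n in sequentially. cmod (K (r n) a) = cmod (K (r n) 0)"
      using eventually_H[OF a]
      by eventually_elim (use K_shift[of a _ 0] in \<open>simp add: norm_mult\<close>)
    ultimately show "(\<lambda>n. cmod (K (r n) 0)) \<longlonglongrightarrow> cmod (L a)"
      by (rule Lim_transform_eventually)
  qed
  have L_comp: "continuous_on UNIV (\<lambda>a. L (x + a))" for x
    by (rule continuous_on_compose2[OF L_cont]) (auto intro!: continuous_intros)
  have mult: "L (x + a) * L 0 = L x * L a" for x a
  proof -
    have "closed {a. L (x + a) * L 0 = L x * L a}"
      by (intro closed_Collect_eq continuous_intros L_comp L_cont)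
    then have "closure (\<Union>j. H j) \<subseteq> {a. L (x + a) * L 0 = L x * L a}"
      by (intro closure_minimal) (use mult_H in auto)
    then show ?thesis using dense by auto
  qed
  have norm_L: "cmod (L a) = cmod (L 0)" for a
  proof -
    have "closed {a. cmod (L a) = cmod (L 0)}"
      by (intro closed_Collect_eq continuous_intros L_cont)
    then have "closure (\<Union>j. H j) \<subseteq> {a. cmod (L a) = cmod (L 0)}"
      by (intro closure_minimal) (use norm_H in auto)
    then show ?thesis using dense by auto
  qed
  define \<theta> where "\<theta> = Abs_dual_group (\<lambda>x. L x / L 0)"
  have chr_\<theta>: "chr \<theta> = (\<lambda>x. L x / L 0)"
    unfolding \<theta>_def
  proof (rule chr_Abs)
    show "continuous_on UNIV (\<lambda>x. L x / L 0)"
      using L0 by (intro continuous_intros L_cont) auto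
    show "cmod (L x / L 0) = 1" for x
      using L0 norm_L[of x] by (simp add: norm_divide)
    show "L (x + y) / L 0 = L x / L 0 * (L y / L 0)" for x y
      using mult[of x y] L0 by (simp add: field_simps)
  qed
  then have L_eq: "L = (\<lambda>x. L 0 * chr \<theta> x)"
    using L0 by auto
  have kL2: "k \<in> L2 M" unfolding k_def by (rule autocorrelation_L2[OF g])
  have K_meas: "K j \<in> borel_measurable M" for j
    by (rule continuous_measurable[OF continuous_if_modulus[OF g K_diff]])
  have L_meas: "L \<in> borel_measurable M"
    by (rule continuous_measurable[OF L_cont])
  have KL2: "K j \<in> L2 M" for j
    by (rule L2_bounded[OF K_meas K_bound])
  have LL2: "L \<in> L2 M"
    by (rule L2_bounded[OF L_meas, of "cmod (L 0)"]) (rule eq_refl[OF norm_L])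
  have lim: "(\<lambda>n. l2_inner M (F n) (K (r n))) \<longlonglongrightarrow> l2_inner M G L"
    if FL2: "\<And>n. F n \<in> L2 M" and GL2: "G \<in> L2 M" and F: "\<And>x. (\<lambda>n. F n x) \<longlonglongrightarrow> G x"
      and F_bound: "\<And>n x. cmod (F n x) \<le> B" for F G
    unfolding l2_inner_def
  proof (rule integral_dominated_convergence[where w = "\<lambda>_. B * B"])
    show "AE x in M. (\<lambda>n. F n x * cnj (K (r n) x)) \<longlonglongrightarrow> G x * cnj (L x)"
      by (intro AE_I2 tendsto_intros F L)
    show "AE x in M. norm (F n x * cnj (K (r n) x)) \<le> B * B" for n
    proof (rule AE_I2)
      fix x
      have "cmod (F n x) * cmod (K (r n) x) \<le> B * B"
        by (intro mult_mono F_bound K_bound) (simp_all add: B_def)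
      then show "norm (F n x * cnj (K (r n) x)) \<le> B * B" by (simp add: norm_mult)
    qed
  qed (use L2_prod_integrable[OF FL2 KL2] L2_prod_integrable[OF GL2 LL2] in \<open>auto intro: borel_measurable_integrable\<close>)
  have "(\<lambda>n. l2_inner M k (K (r n))) \<longlonglongrightarrow> l2_inner M k L"
    by (rule lim) (use kL2 autocorrelation_le[OF g] in \<open>auto simp: B_def k_def\<close>)
  moreover have "(\<lambda>n. l2_inner M (K (r n)) (K (r n))) \<longlonglongrightarrow> l2_inner M L L"
    by (rule lim) (use KL2 LL2 L K_bound in auto)
  moreover have "l2_inner M k (K j) = l2_inner M (K j) (K j)" for j
    unfolding K_def by (rule inner_char_average[OF subgroup kL2])
  ultimately have "l2_inner M k L = l2_inner M L L"
    using LIMSEQ_unique by auto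
  also have "l2_inner M L L = of_real ((cmod (L 0))\<^sup>2)"
  proof -
    have "(LINT x|M. (cmod (L x))\<^sup>2) = (LINT x|M. (cmod (L 0))\<^sup>2)"
      by (intro Bochner_Integration.integral_cong refl arg_cong[OF norm_L])
    then show ?thesis unfolding inner_self using prob_space by simp
  qed
  also have "l2_inner M k L = cnj (L 0) * l2_inner M k (chr \<theta>)"
    by (rule trans[OF arg_cong[OF L_eq, of "l2_inner M k"] inner_scale_right])
  also have "l2_inner M k (chr \<theta>) = 0"
    unfolding k_def by (rule inner_autocorrelation_chr[OF g fourier_0])
  finally show False using L0 by simp
qed

corollary fourier_inj_AE:
  assumes "f \<in> L2 M" "g \<in> L2 M" "\<And>\<xi>. fourier M f \<xi> = fourier M g \<xi>"
  shows "AE x in M. f x = g x"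
proof -
  have "AE x in M. f x - g x = 0"
    by (rule fourier_eq_0_imp_AE)
      (use assms in \<open>auto simp: fourier_inner inner_diff_left[OF _ _ chr_L2] intro: L2_diff\<close>)
  then show ?thesis by simp
qed

end

section \<open>Digits and characters of the iterated kernels\<close>

lemma sum_chr_subgroup:
  assumes H: "finite_subgroup H"
  shows "(\<Sum>a\<in>H. chr \<xi> a) = (if \<xi> \<in> annihilator H then of_nat (card H) else 0)"
proof (cases "\<xi> \<in> annihilator H")
  case True
  then show ?thesis by (simp add: annihilator_def)
next
  case False
  then obtain b where b: "b \<in> H" "chr \<xi> b \<noteq> 1" by (auto simp: annihilator_def)
  have "(\<Sum>a\<in>H. chr \<xi> a) * chr \<xi> b = (\<Sum>a\<in>H. chr \<xi> (a + b))"
    by (simp add: sum_distrib_right chr_add_arg)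
  also have "\<dots> = (\<Sum>a\<in>H. chr \<xi> a)"
    by (rule sum_subgroup_shift[OF H b(1)])
  finally have "(\<Sum>a\<in>H. chr \<xi> a) * (chr \<xi> b - 1) = 0" by (simp add: algebra_simps)
  with False b(2) show ?thesis by simp
qed

lemma annihilator_zero [simp]: "0 \<in> annihilator H"
  by (simp add: annihilator_def)

lemma diff_mem_annihilator_iff: "\<xi> - \<eta> \<in> annihilator H \<longleftrightarrow> (\<forall>a\<in>H. chr \<xi> a = chr \<eta> a)"
proof -
  have "chr \<xi> a * cnj (chr \<eta> a) = 1 \<longleftrightarrow> chr \<xi> a = chr \<eta> a" for a
  proof
    assume "chr \<xi> a * cnj (chr \<eta> a) = 1"
    then have "chr \<xi> a * (cnj (chr \<eta> a) * chr \<eta> a) = chr \<eta> a"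
      by (simp only: mult.assoc[symmetric] mult_1)
    then show "chr \<xi> a = chr \<eta> a" by simp
  qed simp
  then show ?thesis by (simp add: annihilator_def chr_diff)
qed

text \<open>A character that restricts to none of those in \<open>D\<close> would be orthogonal on \<open>H\<close> to their sum, which is
  a multiple of the indicator of \<open>0\<close>.\<close>

lemma complete_characters_cover:
  assumes H: "finite_subgroup H" and D: "complete_characters H D"
  shows "\<exists>\<eta>\<in>D. \<xi> - \<eta> \<in> annihilator H"
proof (rule ccontr)
  assume "\<not> ?thesis"
  then have zero: "(\<Sum>\<eta>\<in>D. \<Sum>a\<in>H. chr (\<xi> - \<eta>) a) = 0"
    by (simp add: sum_chr_subgroup[OF H])
  have "(\<Sum>\<eta>\<in>D. \<Sum>a\<in>H. chr (\<xi> - \<eta>) a) = (\<Sum>a\<in>H. chr \<xi> a * cnj (\<Sum>\<eta>\<in>D. chr \<eta> a))"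
    by (subst sum.swap) (simp add: chr_diff sum_distrib_left)
  also have "\<dots> = (\<Sum>a\<in>H. if a = 0 then of_nat (card H) else 0)"
    using D by (intro sum.cong) (auto simp: complete_characters_def)
  also have "\<dots> = of_nat (card H)"
    using finite_subgroupD(1,2)[OF H] by simp
  finally show False
    using zero finite_subgroupD(6)[OF H] by simp
qed

locale digit_expansion =
  fixes A :: "'a::topological_ab_group_add \<Rightarrow> 'a" and \<pi> :: "nat \<Rightarrow> 'a dual_group"
  assumes A_add: "A (x + y) = A x + A y"
    and A_cont: "continuous_on UNIV A"
    and A_surj: "surj A"
    and finite_ker: "finite (ker A)"
    and digit_system: "digit_system A \<pi>"
begin

abbreviation "m \<equiv> card (ker A)"
abbreviation "dilate j k \<equiv> (adjoint_hom A ^^ j) (\<pi> k)"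

lemma pow_add: "(A ^^ j) (x + y) = (A ^^ j) x + (A ^^ j) y"
  by (induction j arbitrary: x y) (auto simp: A_add)

lemma pow_0 [simp]: "(A ^^ j) 0 = 0"
  using pow_add[of j 0 0] by simp

lemma pow_diff: "(A ^^ j) (x - y) = (A ^^ j) x - (A ^^ j) y"
  using pow_add[of j "x - y" y] by (simp add: algebra_simps)

lemma pow_surj: "surj (A ^^ j)"
proof (induction j)
  case (Suc j)
  show ?case unfolding funpow.simps by (rule comp_surj[OF Suc A_surj])
qed simp

lemma chr_adjoint: "chr (adjoint_hom A \<xi>) x = chr \<xi> (A x)"
proof -
  have "chr (Abs_dual_group (chr \<xi> \<circ> A)) = chr \<xi> \<circ> A"
  proof (rule chr_Abs)
    show "continuous_on UNIV (chr \<xi> \<circ> A)"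
      using A_cont continuous_on_subset[OF continuous_chr subset_UNIV] by (rule continuous_on_compose)
  qed (simp_all add: A_add chr_add_arg)
  then show ?thesis by (simp add: adjoint_hom_def)
qed

lemma chr_adjoint_pow: "chr ((adjoint_hom A ^^ j) \<xi>) x = chr \<xi> ((A ^^ j) x)"
  by (induction j arbitrary: x) (auto simp: chr_adjoint funpow_swap1[of A])

lemma chr_dilate [simp]: "a \<in> ker (A ^^ j) \<Longrightarrow> chr (dilate j k) a = 1"
  by (simp add: chr_adjoint_pow ker_def)

lemma ker_mono: "mono (\<lambda>j. ker (A ^^ j))"
proof (rule incseq_SucI)
  show "ker (A ^^ j) \<subseteq> ker (A ^^ Suc j)" for j
    using pow_0[of 1] by (auto simp: ker_def)
qed

lemma ker_Suc: "x \<in> ker (A ^^ Suc j) \<longleftrightarrow> (A ^^ j) x \<in> ker A"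
  by (simp add: ker_def)

text \<open>\<open>A ^^ j\<close> maps the kernel of \<open>A ^^ Suc j\<close> onto \<open>ker A\<close>, and its fibres are translates of \<open>ker (A ^^ j)\<close>.\<close>

lemma ker_pow: "finite (ker (A ^^ j)) \<and> card (ker (A ^^ j)) = m ^ j"
proof (induction j)
  case 0
  show ?case by (simp add: ker_def)
next
  case (Suc j)
  have fibre: "finite {x. (A ^^ j) x = y} \<and> card {x. (A ^^ j) x = y} = m ^ j" for y
  proof -
    obtain x0 where x0: "(A ^^ j) x0 = y" using pow_surj[of j] by (metis surj_def)
    have "{x. (A ^^ j) x = y} = (\<lambda>x. x0 + x) ` ker (A ^^ j)"
    proof (intro set_eqI iffI)
      fix x assume "x \<in> {x. (A ^^ j) x = y}"
      then have "x - x0 \<in> ker (A ^^ j)" using x0 by (simp add: ker_def pow_diff)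
      then show "x \<in> (\<lambda>x. x0 + x) ` ker (A ^^ j)" by (intro image_eqI[of _ _ "x - x0"]) auto
    qed (auto simp: ker_def pow_add x0)
    then show ?thesis using Suc by (simp add: card_image)
  qed
  have eq: "ker (A ^^ Suc j) = (\<Union>y\<in>ker A. {x. (A ^^ j) x = y})"
  proof (rule set_eqI)
    fix x
    show "x \<in> ker (A ^^ Suc j) \<longleftrightarrow> x \<in> (\<Union>y\<in>ker A. {x. (A ^^ j) x = y})"
      unfolding ker_Suc by simp
  qed
  have "card (ker (A ^^ Suc j)) = (\<Sum>y\<in>ker A. card {x. (A ^^ j) x = y})"
    unfolding eq using finite_ker fibre by (intro card_UN_disjoint) auto
  also have "\<dots> = m * m ^ j" using fibre by simp
  finally have "card (ker (A ^^ Suc j)) = m ^ Suc j" by simp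
  moreover have "finite (ker (A ^^ Suc j))"
    unfolding eq by (rule finite_UN_I[OF finite_ker]) (use fibre in blast)
  ultimately show ?case by blast
qed

lemma ker_subgroup: "finite_subgroup (ker (A ^^ j))"
  using ker_pow[of j] by (auto simp: finite_subgroup_def ker_def pow_diff)

lemma card_ker_pow: "card (ker (A ^^ j)) = m ^ j"
  using ker_pow by blast

lemma m_pos: "m > 0"
  using finite_subgroupD(6)[OF ker_subgroup[of 1]] by simp

lemma pi_eq:
  assumes "k < m" "l < m" "\<pi> k - \<pi> l \<in> annihilator (ker A)"
  shows "k = l"
proof -
  from digit_system have "\<exists>!i. i < m \<and> \<pi> k - \<pi> i \<in> annihilator (ker A)"
    by (simp add: digit_system_def)
  moreover have "\<pi> k - \<pi> k \<in> annihilator (ker A)" by simp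
  ultimately show ?thesis using assms by blast
qed

text \<open>The \<open>m\<close> digits restrict to distinct, hence orthogonal, characters of \<open>ker A\<close>, so the squared moduli
  of their sum \<open>S\<close> add up to \<open>m\<^sup>2\<close> over \<open>ker A\<close>. The value at \<open>0\<close> alone contributes \<open>m\<^sup>2\<close>, which forces all
  others to vanish. That characters separate the points of \<open>ker A\<close> is thus a consequence of their number.\<close>

lemma sum_pi:
  assumes c: "c \<in> ker A"
  shows "(\<Sum>k<m. chr (\<pi> k) c) = (if c = 0 then of_nat m else 0)"
proof -
  define S where "S c = (\<Sum>k<m. chr (\<pi> k) c)" for c
  note K = ker_subgroup[of 1, simplified]
  have "of_real (\<Sum>c\<in>ker A. (cmod (S c))\<^sup>2) = (\<Sum>c\<in>ker A. \<Sum>k<m. \<Sum>l<m. chr (\<pi> k - \<pi> l) c)"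
    by (simp only: of_real_sum complex_norm_square S_def) (simp add: sum_product chr_diff)
  also have "\<dots> = (\<Sum>k<m. \<Sum>l<m. \<Sum>c\<in>ker A. chr (\<pi> k - \<pi> l) c)"
    by (subst sum.swap, rule sum.cong[OF refl], rule sum.swap)
  also have "\<dots> = (\<Sum>k<m. \<Sum>l<m. if l = k then of_nat m else 0)"
    by (intro sum.cong refl) (auto simp: sum_chr_subgroup[OF K] dest: pi_eq)
  also have "\<dots> = of_real ((real m)\<^sup>2)"
    by (simp add: power2_eq_square)
  finally have "(\<Sum>c\<in>ker A. (cmod (S c))\<^sup>2) = (real m)\<^sup>2"
    by (simp only: of_real_eq_iff)
  moreover have "(\<Sum>c\<in>ker A. (cmod (S c))\<^sup>2) = (cmod (S 0))\<^sup>2 + (\<Sum>c\<in>ker A - {0}. (cmod (S c))\<^sup>2)"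
    using finite_ker finite_subgroupD(2)[OF K] by (rule sum.remove)
  moreover have "S 0 = of_nat m" by (simp add: S_def)
  ultimately have "(\<Sum>c\<in>ker A - {0}. (cmod (S c))\<^sup>2) = 0" by simp
  then have "\<forall>c\<in>ker A - {0}. (cmod (S c))\<^sup>2 = 0"
    using finite_ker by (subst (asm) sum_nonneg_eq_0_iff) auto
  with c \<open>S 0 = of_nat m\<close> show ?thesis by (auto simp: S_def)
qed

lemma digits_Suc_image:
  "digits A \<pi> (Suc j) = (\<lambda>(\<eta>, k). \<eta> + dilate j k) ` (digits A \<pi> j \<times> {..<m})"
  by (auto simp: add.commute image_iff)

lemma dilate_eq:
  assumes "k < m" "l < m" "dilate j k - dilate j l \<in> annihilator (ker (A ^^ Suc j))"
  shows "k = l"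
proof (rule pi_eq[OF assms(1,2)], unfold diff_mem_annihilator_iff, rule ballI)
  fix c assume c: "c \<in> ker A"
  obtain x where x: "(A ^^ j) x = c" using pow_surj[of j] by (metis surj_def)
  with c have "x \<in> ker (A ^^ Suc j)" by (simp only: ker_Suc)
  with assms(3) have "chr (dilate j k) x = chr (dilate j l) x"
    unfolding diff_mem_annihilator_iff by blast
  then show "chr (\<pi> k) c = chr (\<pi> l) c" by (simp add: chr_adjoint_pow x)
qed

lemma digits_eq:
  assumes "\<eta> \<in> digits A \<pi> j" "\<eta>' \<in> digits A \<pi> j" "\<eta> - \<eta>' \<in> annihilator (ker (A ^^ j))"
  shows "\<eta> = \<eta>'"
  using assms
proof (induction j arbitrary: \<eta> \<eta>')
  case (Suc j)
  from Suc.prems(1,2) obtain \<theta> k \<theta>' k' where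
    \<eta>: "\<eta> = \<theta> + dilate j k" "\<theta> \<in> digits A \<pi> j" "k < m"
    and \<eta>': "\<eta>' = \<theta>' + dilate j k'" "\<theta>' \<in> digits A \<pi> j" "k' < m"
    unfolding digits_Suc_image by auto
  have "\<theta> - \<theta>' \<in> annihilator (ker (A ^^ j))"
    unfolding diff_mem_annihilator_iff
  proof
    fix a assume a: "a \<in> ker (A ^^ j)"
    moreover have "ker (A ^^ j) \<subseteq> ker (A ^^ Suc j)"
      by (rule monoD[OF ker_mono]) simp
    ultimately have "chr \<eta> a = chr \<eta>' a"
      using Suc.prems(3) unfolding diff_mem_annihilator_iff by blast
    with a show "chr \<theta> a = chr \<theta>' a" by (simp add: \<eta>(1) \<eta>'(1) chr_add)
  qed
  then have eq: "\<theta> = \<theta>'" by (rule Suc.IH[OF \<eta>(2) \<eta>'(2)])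
  with Suc.prems(3) have "dilate j k - dilate j k' \<in> annihilator (ker (A ^^ Suc j))"
    by (simp only: \<eta>(1) \<eta>'(1) add_diff_cancel_left)
  then have "k = k'" by (rule dilate_eq[OF \<eta>(3) \<eta>'(3)])
  with eq show ?case by (simp add: \<eta> \<eta>')
qed simp

lemma digit_split_unique:
  assumes *: "\<theta> \<in> digits A \<pi> j" "k < m" "\<theta>' \<in> digits A \<pi> j" "k' < m"
    and eq: "\<theta> + dilate j k = \<theta>' + dilate j k'"
  shows "\<theta> = \<theta>' \<and> k = k'"
proof -
  have "\<theta> - \<theta>' \<in> annihilator (ker (A ^^ j))"
    unfolding diff_mem_annihilator_iff
  proof
    fix a assume "a \<in> ker (A ^^ j)"
    then show "chr \<theta> a = chr \<theta>' a"
      using arg_cong[OF eq, of "\<lambda>\<xi>. chr \<xi> a"] by (simp add: chr_add)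
  qed
  then have "\<theta> = \<theta>'" by (rule digits_eq[OF *(1,3)])
  moreover from this eq have "dilate j k - dilate j k' \<in> annihilator (ker (A ^^ Suc j))"
    by (simp del: funpow.simps)
  then have "k = k'" by (rule dilate_eq[OF *(2,4)])
  ultimately show ?thesis by simp
qed

lemma inj_digits: "inj_on (\<lambda>(\<eta>, k). \<eta> + dilate j k) (digits A \<pi> j \<times> {..<m})"
  unfolding inj_on_def using digit_split_unique by fastforce

lemma sum_digits_Suc:
  "(\<Sum>\<xi>\<in>digits A \<pi> (Suc j). f \<xi>) = (\<Sum>\<eta>\<in>digits A \<pi> j. \<Sum>k<m. f (\<eta> + dilate j k))"
  unfolding digits_Suc_image
  by (subst sum.reindex[OF inj_digits]) (simp add: sum.cartesian_product case_prod_beta)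

text \<open>The sum over the digits of level \<open>j + 1\<close> factors into the sum over level \<open>j\<close> at \<open>c\<close> and the sum over the
  digits \<open>\<pi> k\<close> at \<open>(A ^^ j) c\<close>; the second factor vanishes unless \<open>c\<close> lies already in \<open>ker (A ^^ j)\<close>.\<close>

lemma complete_characters_digits: "complete_characters (ker (A ^^ j)) (digits A \<pi> j)"
proof (induction j)
  case 0
  then show ?case by (auto simp: complete_characters_def ker_def)
next
  case (Suc j)
  have "finite (digits A \<pi> (Suc j))"
    using Suc unfolding digits_Suc_image complete_characters_def by auto
  moreover have "(\<Sum>\<xi>\<in>digits A \<pi> (Suc j). chr \<xi> c)
      = (if c = 0 then of_nat (card (ker (A ^^ Suc j))) else 0)"
    if c: "c \<in> ker (A ^^ Suc j)" for c
  proof -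
    have "(\<Sum>\<xi>\<in>digits A \<pi> (Suc j). chr \<xi> c)
        = (\<Sum>\<eta>\<in>digits A \<pi> j. chr \<eta> c) * (\<Sum>k<m. chr (\<pi> k) ((A ^^ j) c))"
      unfolding sum_digits_Suc by (simp add: chr_add chr_adjoint_pow sum_product)
    also have "\<dots> = (\<Sum>\<eta>\<in>digits A \<pi> j. chr \<eta> c) * (if c \<in> ker (A ^^ j) then of_nat m else 0)"
      using c by (subst sum_pi) (simp_all only: ker_Suc, simp add: ker_def)
    also have "\<dots> = (if c = 0 then of_nat (card (ker (A ^^ Suc j))) else 0)"
    proof (cases "c \<in> ker (A ^^ j)")
      case True
      then have "(\<Sum>\<eta>\<in>digits A \<pi> j. chr \<eta> c) = (if c = 0 then of_nat (card (ker (A ^^ j))) else 0)"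
        using Suc unfolding complete_characters_def by blast
      with True show ?thesis by (simp add: card_ker_pow del: funpow.simps)
    next
      case False
      moreover have "c \<noteq> 0" using False by (auto simp: ker_def)
      ultimately show ?thesis by simp
    qed
    finally show ?thesis .
  qed
  ultimately show ?case unfolding complete_characters_def by blast
qed

lemma sum_chr_digits:
  assumes "\<eta> \<in> digits A \<pi> j" "\<eta>' \<in> digits A \<pi> j"
  shows "(\<Sum>a\<in>ker (A ^^ j). chr \<eta> a * cnj (chr \<eta>' a)) = (if \<eta> = \<eta>' then of_nat (m ^ j) else 0)"
  using sum_chr_subgroup[OF ker_subgroup, of "\<eta> - \<eta>'" j] digits_eq[OF assms]
  by (auto simp: chr_diff card_ker_pow)

end

section \<open>The wavelet basis\<close>

lemma char_average_eq_sum_translate: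
  assumes H: "finite_subgroup H"
  shows "char_average H \<xi> f = (\<lambda>x. \<Sum>a\<in>H. (chr \<xi> a / of_nat (card H)) * translate a f x)"
proof
  fix x
  have "(\<Sum>a\<in>H. cnj (chr \<xi> a) * f (x + a)) = (\<Sum>a\<in>H. chr \<xi> a * f (x - a))"
    by (rule sum.reindex_bij_witness[of _ uminus uminus])
      (use finite_subgroupD(4)[OF H] in \<open>auto simp: chr_uminus_arg\<close>)
  then show "char_average H \<xi> f x = (\<Sum>a\<in>H. (chr \<xi> a / of_nat (card H)) * translate a f x)"
    by (simp add: char_average_def translate_def sum_divide_distrib)
qed

lemma sum_char_average_at:
  assumes "finite_subgroup H" and "complete_characters H D"
  shows "(\<Sum>\<xi>\<in>D. char_average H \<xi> f x) = f x"
  using sum_char_average[OF assms, of "\<lambda>z. f (x + z)"] by (simp add: char_average_def)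

locale orthonormal_mra = second_countable_haar M + digit_expansion A \<pi>
  for M :: "'a::{topological_ab_group_add, second_countable_topology} measure"
    and A :: "'a \<Rightarrow> 'a" and \<pi> :: "nat \<Rightarrow> 'a dual_group" +
  fixes V :: "nat \<Rightarrow> ('a \<Rightarrow> complex) set" and \<phi> :: "nat \<Rightarrow> 'a \<Rightarrow> complex"
  assumes compact: "compact (UNIV :: 'a set)"
    and dense_ker: "closure (\<Union>j. ker (A ^^ j)) = UNIV"
    and V_closed: "closed_l2_subspace M (V j)"
    and V_Suc: "V j \<subseteq> V (Suc j)"
    and V_dense: "l2_closure M (\<Union>j. V j) = L2 M"
    and scaling: "orthonormal_scaling_sequence M A V \<phi>"
    and phi_0: "AE x in M. \<phi> 0 x = 1"
begin

sublocale dense_finite_subgroups M "\<lambda>j. ker (A ^^ j)" "digits A \<pi>"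
  by unfold_locales
    (rule compact ker_subgroup ker_mono dense_ker complete_characters_digits)+

abbreviation "D \<equiv> digits A \<pi>"

lemma V_mono: "i \<le> j \<Longrightarrow> V i \<subseteq> V j"
  using V_Suc by (rule lift_Suc_mono_le)

lemma V_L2: "f \<in> V j \<Longrightarrow> f \<in> L2 M"
  using V_closed[of j] by (auto simp: closed_l2_subspace_def)

lemma V_scale: "f \<in> V j \<Longrightarrow> (\<lambda>x. c * f x) \<in> V j"
  using V_closed[of j] by (auto simp: closed_l2_subspace_def)

lemma V_sum: "(\<And>i. i \<in> I \<Longrightarrow> f i \<in> V j) \<Longrightarrow> (\<lambda>x. \<Sum>i\<in>I. f i x) \<in> V j"
proof (induction I rule: infinite_finite_induct)
  case (insert i I)
  then have "f i \<in> V j" "(\<lambda>x. \<Sum>i\<in>I. f i x) \<in> V j" by auto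
  then have "(\<lambda>x. f i x + (\<Sum>i\<in>I. f i x)) \<in> V j"
    using V_closed[of j] by (simp add: closed_l2_subspace_def)
  with insert.hyps show ?case by simp
qed (use V_closed[of j] in \<open>simp_all add: closed_l2_subspace_def\<close>)

lemma V_AE:
  assumes f: "f \<in> V j" and g: "g \<in> L2 M" and eq: "AE x in M. g x = f x"
  shows "g \<in> V j"
proof -
  note [measurable] = L2_measurable[OF V_L2[OF f]] L2_measurable[OF g]
  have "(LINT x|M. (cmod (g x - f x))\<^sup>2) = (LINT x|M. 0)"
    by (rule integral_cong_AE) (use eq in auto)
  then have "l2_norm M (\<lambda>x. g x - f x) = 0" by (simp add: l2_norm_def)
  with f g have "g \<in> l2_closure M (V j)"
    by (auto simp: l2_closure_def intro!: bexI[of _ f])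
  then show ?thesis using V_closed[of j] by (simp add: closed_l2_subspace_def)
qed

lemma phi_V: "\<phi> j \<in> V j"
  and translate_phi_V: "a \<in> ker (A ^^ j) \<Longrightarrow> translate a (\<phi> j) \<in> V j"
  and V_expand: "f \<in> V j \<Longrightarrow> \<exists>c. AE x in M. f x = (\<Sum>a\<in>ker (A ^^ j). c a * translate a (\<phi> j) x)"
  and phi_orthonormal: "a \<in> ker (A ^^ j) \<Longrightarrow> b \<in> ker (A ^^ j) \<Longrightarrow>
    l2_inner M (translate a (\<phi> j)) (translate b (\<phi> j)) = (if a = b then 1 else 0)"
  using scaling
  by (auto simp: orthonormal_scaling_sequence_def scaling_sequence_def finite_basis_def
      orthonormal_family_def)

lemma phi_L2: "\<phi> j \<in> L2 M"
  by (rule V_L2[OF phi_V])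

text \<open>The component of \<open>\<phi> j\<close> in one coset of the annihilator of \<open>ker (A ^^ j)\<close> on the Fourier side.\<close>

definition packet :: "nat \<Rightarrow> 'a dual_group \<Rightarrow> 'a \<Rightarrow> complex"
  where "packet j \<xi> = char_average (ker (A ^^ j)) \<xi> (\<phi> j)"

lemma packet_eq:
  "packet j \<xi> = (\<lambda>x. \<Sum>a\<in>ker (A ^^ j). (chr \<xi> a / of_nat (m ^ j)) * translate a (\<phi> j) x)"
  by (simp only: packet_def char_average_eq_sum_translate[OF ker_subgroup] card_ker_pow)

lemma packet_V: "packet j \<xi> \<in> V j"
  unfolding packet_eq by (intro V_sum V_scale translate_phi_V)

lemma packet_L2: "packet j \<xi> \<in> L2 M"
  by (rule V_L2[OF packet_V])

lemma packet_translate: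
  assumes "b \<in> ker (A ^^ j)"
  shows "packet j \<xi> (x - b) = cnj (chr \<xi> b) * packet j \<xi> x"
  using char_average_shift[OF ker_subgroup finite_subgroupD(4)[OF ker_subgroup assms]]
  by (simp add: packet_def chr_uminus_arg)

lemma translate_phi_eq:
  assumes "b \<in> ker (A ^^ j)"
  shows "translate b (\<phi> j) x = (\<Sum>\<xi>\<in>D j. cnj (chr \<xi> b) * packet j \<xi> x)"
  using sum_char_average_at[OF ker_subgroup complete_characters_digits, of j "\<phi> j" "x - b"]
  by (simp add: translate_def packet_def[symmetric] packet_translate[OF assms])

lemma packet_inner:
  "l2_inner M (packet j \<xi>) (packet j \<eta>)
    = (if \<xi> - \<eta> \<in> annihilator (ker (A ^^ j)) then 1 / of_nat (m ^ j) else 0)"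
proof -
  let ?K = "ker (A ^^ j)" and ?N = "of_nat (m ^ j) :: complex"
  note tL = L2_translate[OF phi_L2]
  have "l2_inner M (packet j \<xi>) (packet j \<eta>)
      = (\<Sum>a\<in>?K. chr \<xi> a / ?N * l2_inner M (translate a (\<phi> j)) (packet j \<eta>))"
    by (subst (1) packet_eq, rule inner_sum_left) (rule tL packet_L2)+
  also have "\<dots> = (\<Sum>a\<in>?K. chr \<xi> a / ?N * (\<Sum>b\<in>?K. cnj (chr \<eta> b / ?N) *
      l2_inner M (translate a (\<phi> j)) (translate b (\<phi> j))))"
    by (subst packet_eq, subst inner_sum_right) (rule tL refl)+
  also have "\<dots> = (\<Sum>a\<in>?K. chr \<xi> a / ?N * (\<Sum>b\<in>?K. if a = b then cnj (chr \<eta> a / ?N) else 0))"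
    by (intro sum.cong refl arg_cong2[of _ _ _ _ "(*)"]) (simp add: phi_orthonormal)
  also have "\<dots> = (\<Sum>a\<in>?K. chr (\<xi> - \<eta>) a / (?N * ?N))"
    using finite_subgroupD(1)[OF ker_subgroup] by (simp add: chr_diff)
  also have "\<dots> = (\<Sum>a\<in>?K. chr (\<xi> - \<eta>) a) / (?N * ?N)"
    by (simp only: sum_divide_distrib)
  finally show ?thesis
    using m_pos by (simp add: sum_chr_subgroup[OF ker_subgroup] card_ker_pow)
qed

lemma packet_fourier:
  "fourier M (packet j \<xi>) \<eta>
    = (if \<eta> - \<xi> \<in> annihilator (ker (A ^^ j)) then fourier M (\<phi> j) \<eta> else 0)"
proof -
  let ?K = "ker (A ^^ j)" and ?N = "of_nat (m ^ j) :: complex"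
  have "fourier M (packet j \<xi>) \<eta> = (\<Sum>a\<in>?K. chr \<xi> a / ?N * fourier M (translate a (\<phi> j)) \<eta>)"
    unfolding fourier_inner
    by (subst packet_eq, rule inner_sum_left) (rule L2_translate[OF phi_L2] chr_L2)+
  also have "\<dots> = (\<Sum>a\<in>?K. cnj (chr (\<eta> - \<xi>) a) * (fourier M (\<phi> j) \<eta> / ?N))"
    by (simp add: fourier_translate[OF phi_L2] chr_diff mult_ac)
  also have "\<dots> = cnj (\<Sum>a\<in>?K. chr (\<eta> - \<xi>) a) * (fourier M (\<phi> j) \<eta> / ?N)"
    by (simp only: sum_distrib_right cnj_sum)
  finally show ?thesis
    using m_pos by (simp add: sum_chr_subgroup[OF ker_subgroup] card_ker_pow)
qed

definition multiplier :: "nat \<Rightarrow> ('a dual_group \<Rightarrow> complex) \<Rightarrow> 'a \<Rightarrow> complex"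
  where "multiplier j \<alpha> = (\<lambda>x. \<Sum>\<xi>\<in>D j. \<alpha> \<xi> * packet j \<xi> x)"

lemma multiplier_V: "multiplier j \<alpha> \<in> V j"
  unfolding multiplier_def by (intro V_sum V_scale packet_V)

lemma multiplier_L2: "multiplier j \<alpha> \<in> L2 M"
  by (rule V_L2[OF multiplier_V])

lemma finite_D: "finite (D j)"
  using complete_characters_digits by (simp add: complete_characters_def)

lemma multiplier_inner:
  "l2_inner M (multiplier j \<alpha>) (multiplier j \<beta>) = (\<Sum>\<xi>\<in>D j. \<alpha> \<xi> * cnj (\<beta> \<xi>)) / of_nat (m ^ j)"
proof -
  have "l2_inner M (multiplier j \<alpha>) (multiplier j \<beta>)
      = (\<Sum>\<xi>\<in>D j. \<alpha> \<xi> * l2_inner M (packet j \<xi>) (multiplier j \<beta>))"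
    unfolding multiplier_def[of j \<alpha>]
    by (rule inner_sum_left) (rule packet_L2 multiplier_L2)+
  also have "\<dots> = (\<Sum>\<xi>\<in>D j. \<alpha> \<xi> * (\<Sum>\<eta>\<in>D j. cnj (\<beta> \<eta>) * l2_inner M (packet j \<xi>) (packet j \<eta>)))"
    unfolding multiplier_def by (subst inner_sum_right) (rule packet_L2 refl)+
  also have "\<dots> = (\<Sum>\<xi>\<in>D j. \<alpha> \<xi> * (\<Sum>\<eta>\<in>D j. if \<xi> = \<eta> then cnj (\<beta> \<xi>) / of_nat (m ^ j) else 0))"
  proof (intro sum.cong refl arg_cong2[of _ _ _ _ "(*)"])
    fix \<xi> \<eta> assume "\<xi> \<in> D j" "\<eta> \<in> D j"
    then have "\<xi> - \<eta> \<in> annihilator (ker (A ^^ j)) \<longleftrightarrow> \<xi> = \<eta>"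
      using digits_eq by auto
    then show "cnj (\<beta> \<eta>) * l2_inner M (packet j \<xi>) (packet j \<eta>)
        = (if \<xi> = \<eta> then cnj (\<beta> \<xi>) / of_nat (m ^ j) else 0)"
      by (simp add: packet_inner)
  qed
  also have "\<dots> = (\<Sum>\<xi>\<in>D j. \<alpha> \<xi> * cnj (\<beta> \<xi>)) / of_nat (m ^ j)"
    using finite_D by (simp add: sum_divide_distrib)
  finally show ?thesis .
qed

lemma multiplier_translate:
  assumes "b \<in> ker (A ^^ j)"
  shows "translate b (multiplier j \<alpha>) = multiplier j (\<lambda>\<xi>. cnj (chr \<xi> b) * \<alpha> \<xi>)"
  by (simp add: multiplier_def translate_def packet_translate[OF assms] mult_ac)

text \<open>This is where uniqueness of Fourier coefficients enters: the wavelets are prescribed only through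
  their Fourier transforms, and have to be identified as functions in \<open>V\<close>.\<close>

lemma multiplier_AE:
  assumes f: "f \<in> L2 M"
    and fourier_f: "\<And>\<xi> \<eta>. \<eta> \<in> D j \<Longrightarrow> \<xi> - \<eta> \<in> annihilator (ker (A ^^ j)) \<Longrightarrow>
      fourier M f \<xi> = \<alpha> \<eta> * fourier M (\<phi> j) \<xi>"
  shows "AE x in M. f x = multiplier j \<alpha> x"
proof (rule fourier_inj_AE[OF f multiplier_L2])
  fix \<xi>
  obtain \<eta> where \<eta>: "\<eta> \<in> D j" "\<xi> - \<eta> \<in> annihilator (ker (A ^^ j))"
    using complete_characters_cover[OF ker_subgroup complete_characters_digits] by blast
  have iff: "\<xi> - \<theta> \<in> annihilator (ker (A ^^ j)) \<longleftrightarrow> \<theta> = \<eta>" if "\<theta> \<in> D j" for \<theta>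
  proof
    assume "\<xi> - \<theta> \<in> annihilator (ker (A ^^ j))"
    with \<eta>(2) have "\<theta> - \<eta> \<in> annihilator (ker (A ^^ j))"
      unfolding diff_mem_annihilator_iff by auto
    then show "\<theta> = \<eta>" by (rule digits_eq[OF that \<eta>(1)])
  qed (use \<eta> in simp)
  have "fourier M (multiplier j \<alpha>) \<xi> = (\<Sum>\<theta>\<in>D j. \<alpha> \<theta> * fourier M (packet j \<theta>) \<xi>)"
    unfolding fourier_inner multiplier_def by (rule inner_sum_left) (rule packet_L2 chr_L2)+
  also have "\<dots> = (\<Sum>\<theta>\<in>D j. if \<theta> = \<eta> then \<alpha> \<eta> * fourier M (\<phi> j) \<xi> else 0)"
    by (intro sum.cong refl) (simp add: packet_fourier iff)
  also have "\<dots> = \<alpha> \<eta> * fourier M (\<phi> j) \<xi>"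
    using finite_D \<eta>(1) by simp
  also have "\<dots> = fourier M f \<xi>" using fourier_f[OF \<eta>] by simp
  finally show "fourier M f \<xi> = fourier M (multiplier j \<alpha>) \<xi>" ..
qed

text \<open>Otherwise the packet of the coset would vanish, against its norm computed from the orthonormal
  translates. It makes the refinement mask unique.\<close>

lemma phi_fourier_nonzero:
  "\<exists>\<xi>. \<xi> - \<eta> \<in> annihilator (ker (A ^^ j)) \<and> fourier M (\<phi> j) \<xi> \<noteq> 0"
proof (rule ccontr)
  assume "\<not> ?thesis"
  then have "AE x in M. packet j \<eta> x = 0"
    by (intro fourier_eq_0_imp_AE packet_L2) (auto simp: packet_fourier)
  then have "l2_inner M (packet j \<eta>) (packet j \<eta>) = l2_inner M (\<lambda>_. 0) (packet j \<eta>)"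
    by (intro inner_cong_AE packet_L2) auto
  also have "\<dots> = 0" by (simp add: l2_inner_def)
  finally show False using m_pos by (simp add: packet_inner)
qed

text \<open>Expanding \<open>\<phi> j\<close> in the translates of \<open>\<phi> (Suc j)\<close> exhibits the quotient of the Fourier transforms as a
  trigonometric polynomial over \<open>ker (A ^^ Suc j)\<close>, which is constant on cosets.\<close>

lemma refinement_mask:
  assumes "\<xi> - \<eta> \<in> annihilator (ker (A ^^ Suc j))"
  shows "fourier M (\<phi> j) \<xi> = refinement_mask M A \<phi> j \<eta> * fourier M (\<phi> (Suc j)) \<xi>"
proof -
  let ?K = "ker (A ^^ Suc j)"
  have "\<phi> j \<in> V (Suc j)" using phi_V V_Suc by blast
  then obtain c where c: "AE x in M. \<phi> j x = (\<Sum>a\<in>?K. c a * translate a (\<phi> (Suc j)) x)"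
    using V_expand by blast
  define \<mu> where "\<mu> \<xi> = (\<Sum>a\<in>?K. c a * cnj (chr \<xi> a))" for \<xi>
  have \<mu>: "fourier M (\<phi> j) \<xi> = \<mu> \<xi> * fourier M (\<phi> (Suc j)) \<xi>" for \<xi>
  proof -
    have "fourier M (\<phi> j) \<xi> = fourier M (\<lambda>x. \<Sum>a\<in>?K. c a * translate a (\<phi> (Suc j)) x) \<xi>"
      unfolding fourier_inner
      by (rule inner_cong_AE[OF _ _ _ _ c]) (intro phi_L2 L2_sum L2_scale L2_translate chr_L2 AE_I2 refl)+
    also have "\<dots> = (\<Sum>a\<in>?K. c a * fourier M (translate a (\<phi> (Suc j))) \<xi>)"
      unfolding fourier_inner by (rule inner_sum_left) (rule L2_translate[OF phi_L2] chr_L2)+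
    finally show ?thesis
      by (simp only: fourier_translate[OF phi_L2] \<mu>_def sum_distrib_right mult.assoc)
  qed
  have \<mu>_cong: "\<mu> \<xi> = \<mu> \<eta>" if "\<xi> - \<eta> \<in> annihilator ?K" for \<xi>
    using that unfolding \<mu>_def diff_mem_annihilator_iff by simp
  obtain \<xi>0 where \<xi>0: "\<xi>0 - \<eta> \<in> annihilator ?K" "fourier M (\<phi> (Suc j)) \<xi>0 \<noteq> 0"
    using phi_fourier_nonzero by blast
  have "refinement_mask M A \<phi> j \<eta> = \<mu> \<eta>"
    unfolding refinement_mask_def
  proof (rule the_equality)
    show "\<forall>\<xi>. \<xi> - \<eta> \<in> annihilator ?K \<longrightarrow> fourier M (\<phi> j) \<xi> = \<mu> \<eta> * fourier M (\<phi> (Suc j)) \<xi>"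
      using \<mu> \<mu>_cong by metis
    fix d assume "\<forall>\<xi>. \<xi> - \<eta> \<in> annihilator ?K \<longrightarrow> fourier M (\<phi> j) \<xi> = d * fourier M (\<phi> (Suc j)) \<xi>"
    with \<xi>0 \<mu>[of \<xi>0] \<mu>_cong[of \<xi>0] show "d = \<mu> \<eta>" by auto
  qed
  then show ?thesis using \<mu>[of \<xi>] \<mu>_cong[OF assms] by simp
qed

text \<open>For one level \<open>j\<close>, the scaling function is treated on a par with the wavelets, as the member \<open>W 0\<close> of a
  family whose multipliers are given by all rows of the unitary matrices.\<close>

context
  fixes j :: nat and W :: "nat \<Rightarrow> 'a \<Rightarrow> complex"
    and \<beta> :: "nat \<Rightarrow> 'a dual_group \<Rightarrow> complex"
    and B :: "'a dual_group \<Rightarrow> nat \<Rightarrow> nat \<Rightarrow> complex"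
  assumes W_L2: "\<And>\<nu>. \<nu> < m \<Longrightarrow> W \<nu> \<in> L2 M"
    and W_AE: "\<And>\<nu>. \<nu> < m \<Longrightarrow> AE x in M. W \<nu> x = multiplier (Suc j) (\<beta> \<nu>) x"
    and \<beta>_eq: "\<And>\<nu> \<eta> k. \<nu> < m \<Longrightarrow> \<eta> \<in> D j \<Longrightarrow> k < m \<Longrightarrow>
      \<beta> \<nu> (\<eta> + dilate j k) = of_real (sqrt (real m)) * B \<eta> \<nu> k"
    and unitary: "\<And>\<eta>. \<eta> \<in> D j \<Longrightarrow> unitary_matrix m (B \<eta>)"
begin

lemma W_translate_AE:
  assumes "\<nu> < m" "a \<in> ker (A ^^ j)"
  shows "AE x in M. translate a (W \<nu>) x = multiplier (Suc j) (\<lambda>\<xi>. cnj (chr \<xi> a) * \<beta> \<nu> \<xi>) x"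
proof -
  have "a \<in> ker (A ^^ Suc j)" using assms(2) monoD[OF ker_mono, of j "Suc j"] by auto
  from AE_translate[OF W_AE[OF assms(1)], of a] show ?thesis
    unfolding multiplier_translate[OF \<open>a \<in> ker (A ^^ Suc j)\<close>] .
qed

lemma W_translate_V:
  assumes "\<nu> < m" "a \<in> ker (A ^^ j)"
  shows "translate a (W \<nu>) \<in> V (Suc j)"
  by (rule V_AE[OF multiplier_V L2_translate[OF W_L2] W_translate_AE[OF assms]]) (rule assms(1))

lemma sqrt_m_sq: "complex_of_real (sqrt (real m)) * complex_of_real (sqrt (real m)) = of_nat m"
  by (simp flip: of_real_mult)

text \<open>The sum over the digits of level \<open>j + 1\<close> splits into a sum over \<open>k\<close>, evaluated by orthonormality of the rows
  of \<open>B \<eta>\<close>, and a sum over \<open>\<eta>\<close>, evaluated by the character table of \<open>ker (A ^^ j)\<close>; the digits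
  \<open>dilate j k\<close> are trivial on that kernel.\<close>

lemma W_orthonormal:
  assumes \<nu>: "\<nu> < m" "\<nu>' < m" and ab: "a \<in> ker (A ^^ j)" "b \<in> ker (A ^^ j)"
  shows "l2_inner M (translate a (W \<nu>)) (translate b (W \<nu>')) = (if \<nu> = \<nu>' \<and> a = b then 1 else 0)"
proof -
  have "l2_inner M (translate a (W \<nu>)) (translate b (W \<nu>'))
    = l2_inner M (multiplier (Suc j) (\<lambda>\<xi>. cnj (chr \<xi> a) * \<beta> \<nu> \<xi>))
        (multiplier (Suc j) (\<lambda>\<xi>. cnj (chr \<xi> b) * \<beta> \<nu>' \<xi>))"
    by (intro inner_cong_AE L2_translate W_L2 \<nu> multiplier_L2 W_translate_AE ab)
  also have "\<dots> = (\<Sum>\<eta>\<in>D j. \<Sum>k<m. cnj (chr (\<eta> + dilate j k) a) * \<beta> \<nu> (\<eta> + dilate j k) *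
      cnj (cnj (chr (\<eta> + dilate j k) b) * \<beta> \<nu>' (\<eta> + dilate j k))) / of_nat (m ^ Suc j)"
    by (simp only: multiplier_inner sum_digits_Suc)
  also have "(\<Sum>\<eta>\<in>D j. \<Sum>k<m. cnj (chr (\<eta> + dilate j k) a) * \<beta> \<nu> (\<eta> + dilate j k) *
      cnj (cnj (chr (\<eta> + dilate j k) b) * \<beta> \<nu>' (\<eta> + dilate j k)))
    = (\<Sum>\<eta>\<in>D j. \<Sum>k<m. (of_nat m * chr \<eta> (b - a)) * (B \<eta> \<nu> k * cnj (B \<eta> \<nu>' k)))"
  proof (intro sum.cong refl)
    fix \<eta> k assume "\<eta> \<in> D j" "k \<in> {..<m}"
    then show "cnj (chr (\<eta> + dilate j k) a) * \<beta> \<nu> (\<eta> + dilate j k) *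
        cnj (cnj (chr (\<eta> + dilate j k) b) * \<beta> \<nu>' (\<eta> + dilate j k))
      = (of_nat m * chr \<eta> (b - a)) * (B \<eta> \<nu> k * cnj (B \<eta> \<nu>' k))"
      using \<nu> ab by (simp add: \<beta>_eq chr_add chr_diff_arg mult_ac flip: sqrt_m_sq)
  qed
  also have "\<dots> = (\<Sum>\<eta>\<in>D j. (of_nat m * chr \<eta> (b - a)) * (\<Sum>k<m. B \<eta> \<nu> k * cnj (B \<eta> \<nu>' k)))"
    by (simp only: sum_distrib_left)
  also have "\<dots> = (\<Sum>\<eta>\<in>D j. (of_nat m * chr \<eta> (b - a)) * (if \<nu> = \<nu>' then 1 else 0))"
    using unitary \<nu> by (intro sum.cong refl) (simp add: unitary_matrix_def)
  also have "\<dots> = (of_nat m * (if \<nu> = \<nu>' then 1 else 0)) * (\<Sum>\<eta>\<in>D j. chr \<eta> (b - a))"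
    by (simp add: sum_distrib_left mult_ac)
  also have "(\<Sum>\<eta>\<in>D j. chr \<eta> (b - a)) = (if b - a = 0 then of_nat (m ^ j) else 0)"
    using complete_characters_digits[of j] finite_subgroupD(3)[OF ker_subgroup ab(2,1)]
    unfolding complete_characters_def card_ker_pow by blast
  finally show ?thesis using m_pos by auto
qed

text \<open>The linear system expressing the translates in terms of the packets is inverted explicitly: summing over
  \<open>a\<close> against \<open>\<theta>\<close> isolates the packets of the digits \<open>\<theta> + dilate j k\<close>, and summing over \<open>\<nu>\<close> against column \<open>l\<close> of
  \<open>B \<theta>\<close> isolates \<open>k = l\<close>.\<close>

lemma packet_W_span:
  assumes "\<xi> \<in> D (Suc j)"
  shows "\<exists>c. AE x in M. packet (Suc j) \<xi> x
    = (\<Sum>\<nu><m. \<Sum>a\<in>ker (A ^^ j). c \<nu> a * translate a (W \<nu>) x)"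
proof -
  let ?K = "ker (A ^^ j)" and ?s = "complex_of_real (sqrt (real m))"
  obtain \<theta> l where \<xi>: "\<xi> = \<theta> + dilate j l" "\<theta> \<in> D j" "l < m"
    using assms unfolding digits_Suc_image by auto
  \<comment> \<open>Conjugate transpose of the coefficient matrix, divided by the common squared length of its columns.\<close>
  define c where "c \<nu> a = cnj (B \<theta> \<nu> l) * chr \<theta> a / (?s * of_nat (m ^ j))" for \<nu> a
  have s: "?s * of_nat (m ^ j) \<noteq> 0" using m_pos by simp
  have finK: "finite ?K" by (rule finite_subgroupD(1)[OF ker_subgroup])
  have "AE x in M. \<forall>\<nu>\<in>{..<m}. \<forall>a\<in>?K.
      translate a (W \<nu>) x = multiplier (Suc j) (\<lambda>\<xi>. cnj (chr \<xi> a) * \<beta> \<nu> \<xi>) x"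
    using finK by (intro AE_finite_allI W_translate_AE) auto
  then have "AE x in M. packet (Suc j) \<xi> x = (\<Sum>\<nu><m. \<Sum>a\<in>?K. c \<nu> a * translate a (W \<nu>) x)"
  proof eventually_elim
    case (elim x)
    define p where "p \<eta> k = packet (Suc j) (\<eta> + dilate j k) x" for \<eta> k
    have W_eq: "translate a (W \<nu>) x = (\<Sum>\<eta>\<in>D j. \<Sum>k<m. cnj (chr \<eta> a) * (?s * B \<eta> \<nu> k) * p \<eta> k)"
      if "\<nu> < m" "a \<in> ?K" for \<nu> a
    proof -
      have "translate a (W \<nu>) x = multiplier (Suc j) (\<lambda>\<xi>. cnj (chr \<xi> a) * \<beta> \<nu> \<xi>) x"
        using elim that by blast
      also have "\<dots> = (\<Sum>\<eta>\<in>D j. \<Sum>k<m. cnj (chr \<eta> a) * (?s * B \<eta> \<nu> k) * p \<eta> k)"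
        unfolding multiplier_def sum_digits_Suc p_def
        using that by (intro sum.cong refl) (simp add: chr_add \<beta>_eq)
      finally show ?thesis .
    qed
    have "(\<Sum>\<nu><m. \<Sum>a\<in>?K. c \<nu> a * translate a (W \<nu>) x)
      = (\<Sum>\<nu><m. \<Sum>a\<in>?K. \<Sum>\<eta>\<in>D j. \<Sum>k<m. c \<nu> a * (cnj (chr \<eta> a) * (?s * B \<eta> \<nu> k) * p \<eta> k))"
      by (intro sum.cong refl) (simp add: W_eq sum_distrib_left)
    also have "\<dots> = (\<Sum>\<nu><m. \<Sum>\<eta>\<in>D j. \<Sum>k<m. \<Sum>a\<in>?K. c \<nu> a * (cnj (chr \<eta> a) * (?s * B \<eta> \<nu> k) * p \<eta> k))"
      by (rule sum.cong[OF refl], subst sum.swap, rule sum.cong[OF refl], rule sum.swap)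
    also have "\<dots> = (\<Sum>\<eta>\<in>D j. \<Sum>k<m. \<Sum>\<nu><m. \<Sum>a\<in>?K. c \<nu> a * (cnj (chr \<eta> a) * (?s * B \<eta> \<nu> k) * p \<eta> k))"
      by (subst sum.swap, rule sum.cong[OF refl], rule sum.swap)
    also have "\<dots> = (\<Sum>\<eta>\<in>D j. \<Sum>k<m. p \<eta> k / of_nat (m ^ j) *
        (\<Sum>\<nu><m. cnj (B \<theta> \<nu> l) * B \<eta> \<nu> k) * (\<Sum>a\<in>?K. chr \<theta> a * cnj (chr \<eta> a)))"
      using m_pos by (intro sum.cong refl) (simp add: c_def sum_distrib_left sum_distrib_right sum_divide_distrib mult_ac)
    also have "\<dots> = (\<Sum>\<eta>\<in>D j. if \<eta> = \<theta> then \<Sum>k<m. p \<theta> k * (\<Sum>\<nu><m. cnj (B \<theta> \<nu> l) * B \<theta> \<nu> k) else 0)"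
      using m_pos by (intro sum.cong refl) (auto simp: sum_chr_digits[OF \<xi>(2)])
    also have "\<dots> = (\<Sum>k<m. p \<theta> k * (\<Sum>\<nu><m. cnj (B \<theta> \<nu> l) * B \<theta> \<nu> k))"
      using finite_D \<xi>(2) by simp
    also have "\<dots> = (\<Sum>k<m. if k = l then p \<theta> l else 0)"
      using unitary[OF \<xi>(2)] \<xi>(3) by (intro sum.cong refl) (auto simp: unitary_matrix_def)
    also have "\<dots> = packet (Suc j) \<xi> x" using \<xi> by (simp add: p_def)
    finally show ?case ..
  qed
  then show ?thesis by blast
qed

end

lemma V_perp_W:
  assumes f: "f \<in> V j" and W: "W 0 = \<phi> j" "\<And>\<nu>. \<nu> < m \<Longrightarrow> W \<nu> \<in> L2 M"
    and orth: "\<And>\<nu> \<nu>' a b. \<nu> < m \<Longrightarrow> \<nu>' < m \<Longrightarrow> a \<in> ker (A ^^ j) \<Longrightarrow> b \<in> ker (A ^^ j) \<Longrightarrow>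
      l2_inner M (translate a (W \<nu>)) (translate b (W \<nu>')) = (if \<nu> = \<nu>' \<and> a = b then 1 else 0)"
    and \<nu>: "0 < \<nu>" "\<nu> < m" and b: "b \<in> ker (A ^^ j)"
  shows "l2_inner M f (translate b (W \<nu>)) = 0"
proof -
  obtain c where c: "AE x in M. f x = (\<Sum>a\<in>ker (A ^^ j). c a * translate a (\<phi> j) x)"
    using V_expand[OF f] by blast
  have WL: "translate b (W \<nu>) \<in> L2 M" by (intro L2_translate W \<nu>)
  have "l2_inner M f (translate b (W \<nu>))
      = l2_inner M (\<lambda>x. \<Sum>a\<in>ker (A ^^ j). c a * translate a (\<phi> j) x) (translate b (W \<nu>))"
    by (rule inner_cong_AE[OF _ _ _ _ c]) (intro V_L2[OF f] L2_sum L2_scale L2_translate phi_L2 WL AE_I2 refl)+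
  also have "\<dots> = (\<Sum>a\<in>ker (A ^^ j). c a * l2_inner M (translate a (\<phi> j)) (translate b (W \<nu>)))"
    by (rule inner_sum_left) (rule L2_translate[OF phi_L2] WL)+
  also have "\<dots> = 0"
  proof (intro sum.neutral ballI)
    fix a assume "a \<in> ker (A ^^ j)"
    then show "c a * l2_inner M (translate a (\<phi> j)) (translate b (W \<nu>)) = 0"
      using orth[of 0 \<nu> a b] \<nu> b m_pos W(1) by simp
  qed
  finally show ?thesis .
qed

lemma wavelet_level:
  assumes "wavelet_functions M A \<pi> \<phi> \<psi>"
  obtains W where "W 0 = \<phi> j" and "\<And>\<nu>. 0 < \<nu> \<Longrightarrow> W \<nu> = \<psi> \<nu> j"
    and "\<And>\<nu>. \<nu> < m \<Longrightarrow> W \<nu> \<in> L2 M"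
    and "\<And>\<nu> a. \<nu> < m \<Longrightarrow> a \<in> ker (A ^^ j) \<Longrightarrow> translate a (W \<nu>) \<in> V (Suc j)"
    and "\<And>\<nu> \<nu>' a b. \<nu> < m \<Longrightarrow> \<nu>' < m \<Longrightarrow> a \<in> ker (A ^^ j) \<Longrightarrow> b \<in> ker (A ^^ j) \<Longrightarrow>
      l2_inner M (translate a (W \<nu>)) (translate b (W \<nu>')) = (if \<nu> = \<nu>' \<and> a = b then 1 else 0)"
    and "\<And>\<xi>. \<xi> \<in> D (Suc j) \<Longrightarrow> \<exists>c. AE x in M. packet (Suc j) \<xi> x
      = (\<Sum>\<nu><m. \<Sum>a\<in>ker (A ^^ j). c \<nu> a * translate a (W \<nu>) x)"
proof -
  obtain B :: "nat \<Rightarrow> 'a dual_group \<Rightarrow> nat \<Rightarrow> nat \<Rightarrow> complex" and \<alpha> :: "nat \<Rightarrow> nat \<Rightarrow> 'a dual_group \<Rightarrow> complex"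
    where 1: "\<forall>j. \<forall>\<eta>\<in>D j. unitary_matrix m (B j \<eta>) \<and> (\<forall>k<m.
        B j \<eta> 0 k = refinement_mask M A \<phi> j (\<eta> + dilate j k) / of_real (sqrt (real m)))"
      and 2: "\<forall>\<nu>\<in>{1..<m}. \<forall>j. \<forall>\<eta>\<in>D j. \<forall>k<m.
        \<alpha> \<nu> j (\<eta> + dilate j k) = of_real (sqrt (real m)) * B j \<eta> \<nu> k"
      and 3: "\<forall>\<nu>\<in>{1..<m}. \<forall>j. \<forall>\<eta>\<in>D (Suc j). \<forall>\<xi>.
        \<xi> - \<eta> \<in> annihilator (ker (A ^^ Suc j)) \<longrightarrow> \<alpha> \<nu> j \<xi> = \<alpha> \<nu> j \<eta>"
      and 4: "\<forall>\<nu>\<in>{1..<m}. \<forall>j. \<psi> \<nu> j \<in> L2 M \<and>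
        (\<forall>\<xi>. fourier M (\<psi> \<nu> j) \<xi> = \<alpha> \<nu> j \<xi> * fourier M (\<phi> (Suc j)) \<xi>)"
    using assms unfolding wavelet_functions_def Let_def by (elim exE conjE) (rule that; assumption)
  have B: "unitary_matrix m (B j \<eta>)" if "\<eta> \<in> D j" for \<eta>
    using 1 that by blast
  have B0: "B j \<eta> 0 k = refinement_mask M A \<phi> j (\<eta> + dilate j k) / of_real (sqrt (real m))"
    if "\<eta> \<in> D j" "k < m" for \<eta> k
    using 1 that by blast
  have \<alpha>: "\<alpha> \<nu> j (\<eta> + dilate j k) = of_real (sqrt (real m)) * B j \<eta> \<nu> k"
    if "\<nu> \<in> {1..<m}" "\<eta> \<in> D j" "k < m" for \<nu> \<eta> k
    using 2 that by blast
  have \<alpha>_cong: "\<alpha> \<nu> j \<xi> = \<alpha> \<nu> j \<eta>"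
    if "\<nu> \<in> {1..<m}" "\<eta> \<in> D (Suc j)" "\<xi> - \<eta> \<in> annihilator (ker (A ^^ Suc j))" for \<nu> \<eta> \<xi>
    using 3 that by blast
  have \<psi>: "\<psi> \<nu> j \<in> L2 M"
    "fourier M (\<psi> \<nu> j) \<xi> = \<alpha> \<nu> j \<xi> * fourier M (\<phi> (Suc j)) \<xi>"
    if "\<nu> \<in> {1..<m}" for \<nu> \<xi>
    using 4 that by blast+
  define W where "W \<nu> = (if \<nu> = 0 then \<phi> j else \<psi> \<nu> j)" for \<nu>
  define \<beta> where "\<beta> \<nu> = (if \<nu> = 0 then refinement_mask M A \<phi> j else \<alpha> \<nu> j)" for \<nu>
  have W_L2: "W \<nu> \<in> L2 M" if "\<nu> < m" for \<nu>
    using that by (simp add: W_def phi_L2 \<psi>(1))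
  have W_AE: "AE x in M. W \<nu> x = multiplier (Suc j) (\<beta> \<nu>) x" if "\<nu> < m" for \<nu>
  proof (rule multiplier_AE[OF W_L2[OF that]])
    fix \<xi> \<eta> assume *: "\<eta> \<in> D (Suc j)" "\<xi> - \<eta> \<in> annihilator (ker (A ^^ Suc j))"
    show "fourier M (W \<nu>) \<xi> = \<beta> \<nu> \<eta> * fourier M (\<phi> (Suc j)) \<xi>"
    proof (cases "\<nu> = 0")
      case True
      then show ?thesis using refinement_mask[OF *(2)] by (simp add: W_def \<beta>_def)
    next
      case False
      then have "\<nu> \<in> {1..<m}" using that by simp
      then show ?thesis
        using False \<psi>(2)[of \<nu> \<xi>] \<alpha>_cong[OF _ *, of \<nu>] by (simp only: W_def \<beta>_def if_False)
    qed
  qed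
  have \<beta>_eq: "\<beta> \<nu> (\<eta> + dilate j k) = of_real (sqrt (real m)) * B j \<eta> \<nu> k"
    if "\<nu> < m" "\<eta> \<in> D j" "k < m" for \<nu> \<eta> k
    using that m_pos by (cases "\<nu> = 0") (simp_all add: \<beta>_def B0 \<alpha>)
  show ?thesis
  proof (rule that[of W])
    show "translate a (W \<nu>) \<in> V (Suc j)" if "\<nu> < m" "a \<in> ker (A ^^ j)" for \<nu> a
      by (rule W_translate_V[where B = "B j" and \<beta> = \<beta>]) (rule W_L2 W_AE \<beta>_eq B that; assumption)+
    show "l2_inner M (translate a (W \<nu>)) (translate b (W \<nu>')) = (if \<nu> = \<nu>' \<and> a = b then 1 else 0)"
      if "\<nu> < m" "\<nu>' < m" "a \<in> ker (A ^^ j)" "b \<in> ker (A ^^ j)" for \<nu> \<nu>' a b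
      by (rule W_orthonormal[where B = "B j" and \<beta> = \<beta>]) (rule W_L2 W_AE \<beta>_eq B that; assumption)+
    show "\<exists>c. AE x in M. packet (Suc j) \<xi> x
      = (\<Sum>\<nu><m. \<Sum>a\<in>ker (A ^^ j). c \<nu> a * translate a (W \<nu>) x)" if "\<xi> \<in> D (Suc j)" for \<xi>
      by (rule packet_W_span[where B = "B j" and \<beta> = \<beta>]) (rule W_L2 W_AE \<beta>_eq B that; assumption)+
  qed (simp_all add: W_def W_L2[unfolded W_def])
qed

lemma fin_spanI: "finite J \<Longrightarrow> J \<subseteq> I \<Longrightarrow> (\<lambda>x. \<Sum>i\<in>J. c i * e i x) \<in> fin_span I e"
  unfolding fin_span_def by (intro CollectI exI[of _ J] exI[of _ c] conjI refl)

text \<open>Expansions in \<open>V j\<close> hold only almost everywhere, so spans are taken modulo null functions.\<close>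

definition span_AE :: "'i set \<Rightarrow> ('i \<Rightarrow> 'a \<Rightarrow> complex) \<Rightarrow> ('a \<Rightarrow> complex) set"
  where "span_AE I e = {f. \<exists>g\<in>fin_span I e. AE x in M. f x = g x}"

lemma span_AE_base:
  assumes "i \<in> I"
  shows "e i \<in> span_AE I e"
proof -
  have "(\<lambda>x. \<Sum>i\<in>{i}. 1 * e i x) \<in> fin_span I e"
    using assms by (intro fin_spanI) auto
  then show ?thesis by (auto simp: span_AE_def)
qed

lemma span_AE_scale:
  assumes "f \<in> span_AE I e"
  shows "(\<lambda>x. c * f x) \<in> span_AE I e"
proof -
  from assms obtain J d where J: "finite J" "J \<subseteq> I" "AE x in M. f x = (\<Sum>i\<in>J. d i * e i x)"
    by (auto simp: span_AE_def fin_span_def)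
  have "(\<lambda>x. \<Sum>i\<in>J. (c * d i) * e i x) \<in> fin_span I e"
    using J(1,2) by (rule fin_spanI)
  moreover have "AE x in M. c * f x = (\<Sum>i\<in>J. (c * d i) * e i x)"
    using J(3) by eventually_elim (simp add: sum_distrib_left mult.assoc)
  ultimately show ?thesis by (auto simp: span_AE_def)
qed

lemma span_AE_add:
  assumes "f \<in> span_AE I e" "g \<in> span_AE I e"
  shows "(\<lambda>x. f x + g x) \<in> span_AE I e"
proof -
  from assms obtain J c K d
    where J: "finite J" "J \<subseteq> I" "AE x in M. f x = (\<Sum>i\<in>J. c i * e i x)"
      and K: "finite K" "K \<subseteq> I" "AE x in M. g x = (\<Sum>i\<in>K. d i * e i x)"
    by (auto simp: span_AE_def fin_span_def)
  define b where "b i = (if i \<in> J then c i else 0) + (if i \<in> K then d i else 0)" for i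
  have "(\<lambda>x. \<Sum>i\<in>J \<union> K. b i * e i x) \<in> fin_span I e"
    using J(1,2) K(1,2) by (intro fin_spanI) auto
  moreover have "AE x in M. f x + g x = (\<Sum>i\<in>J \<union> K. b i * e i x)"
    using J(3) K(3)
  proof eventually_elim
    case (elim x)
    have "(\<Sum>i\<in>J \<union> K. b i * e i x) = (\<Sum>i\<in>J \<union> K. (if i \<in> J then c i * e i x else 0))
        + (\<Sum>i\<in>J \<union> K. (if i \<in> K then d i * e i x else 0))"
      unfolding sum.distrib[symmetric] by (intro sum.cong) (auto simp: b_def distrib_right)
    also have "\<dots> = (\<Sum>i\<in>J. c i * e i x) + (\<Sum>i\<in>K. d i * e i x)"
      using J(1) K(1) by (simp add: sum.If_cases Int_absorb1)
    finally show ?case using elim by simp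
  qed
  ultimately show ?thesis by (auto simp: span_AE_def)
qed

lemma span_AE_sum:
  assumes "\<And>k. k \<in> K \<Longrightarrow> f k \<in> span_AE I e"
  shows "(\<lambda>x. \<Sum>k\<in>K. f k x) \<in> span_AE I e"
proof -
  have 0: "(\<lambda>x. 0) \<in> span_AE I e"
  proof -
    have "(\<lambda>x. \<Sum>i\<in>{}. 0 * e i x) \<in> fin_span I e"
      by (rule fin_spanI) auto
    then show ?thesis by (auto simp: span_AE_def)
  qed
  show ?thesis
    using assms
  proof (induction K rule: infinite_finite_induct)
    case (insert k K)
    then have "(\<lambda>x. f k x + (\<Sum>k\<in>K. f k x)) \<in> span_AE I e"
      by (intro span_AE_add) auto
    with insert.hyps show ?case by simp
  qed (use 0 in simp_all)
qed

lemma span_AE_cong: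
  assumes "g \<in> span_AE I e" "AE x in M. f x = g x"
  shows "f \<in> span_AE I e"
proof -
  from assms(1) obtain h where h: "h \<in> fin_span I e" "AE x in M. g x = h x"
    by (auto simp: span_AE_def)
  have "AE x in M. f x = h x"
    using assms(2) h(2) by eventually_elim simp
  with h(1) show ?thesis by (auto simp: span_AE_def)
qed

text \<open>Passing from \<open>V j\<close> to \<open>V (j + 1)\<close>, the packets of level \<open>j + 1\<close> are combinations of translates of \<open>\<phi> j\<close>,
  which lie in \<open>V j\<close>, and of wavelets of level \<open>j\<close>.\<close>

lemma V_subset_wavelet_span:
  assumes \<psi>: "wavelet_functions M A \<pi> \<phi> \<psi>"
  shows "V j \<subseteq> span_AE (wavelet_index A) (wavelet_system \<psi>)" (is "_ \<subseteq> ?S")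
proof (induction j)
  case 0
  have "wavelet_system \<psi> None \<in> ?S"
    by (rule span_AE_base) (simp add: wavelet_index_def)
  then have one: "(\<lambda>_. 1) \<in> ?S" by simp
  show ?case
  proof
    fix f assume "f \<in> V 0"
    then obtain c where "AE x in M. f x = (\<Sum>a\<in>ker (A ^^ 0). c a * translate a (\<phi> 0) x)"
      using V_expand by blast
    then have "AE x in M. f x = c 0 * 1"
      using phi_0 by eventually_elim (simp add: ker_def translate_def)
    with span_AE_scale[OF one] show "f \<in> ?S" by (rule span_AE_cong)
  qed
next
  case (Suc j)
  obtain W where W: "W 0 = \<phi> j" "\<And>\<nu>. 0 < \<nu> \<Longrightarrow> W \<nu> = \<psi> \<nu> j"
    and packets: "\<And>\<xi>. \<xi> \<in> D (Suc j) \<Longrightarrow> \<exists>c. AE x in M. packet (Suc j) \<xi> x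
      = (\<Sum>\<nu><m. \<Sum>a\<in>ker (A ^^ j). c \<nu> a * translate a (W \<nu>) x)"
    by (rule wavelet_level[OF \<psi>, of j]) (rule that; assumption)
  have W_in: "translate a (W \<nu>) \<in> ?S" if "\<nu> < m" "a \<in> ker (A ^^ j)" for \<nu> a
  proof (cases "\<nu> = 0")
    case True
    then show ?thesis using Suc translate_phi_V[OF that(2)] W(1) by auto
  next
    case False
    then have "wavelet_system \<psi> (Some (\<nu>, j, a)) \<in> ?S"
      using that by (intro span_AE_base) (auto simp: wavelet_index_def)
    with False show ?thesis by (simp add: W(2))
  qed
  have packet_in: "packet (Suc j) \<xi> \<in> ?S" if \<xi>: "\<xi> \<in> D (Suc j)" for \<xi>
  proof -
    obtain c where "AE x in M. packet (Suc j) \<xi> x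
        = (\<Sum>\<nu><m. \<Sum>a\<in>ker (A ^^ j). c \<nu> a * translate a (W \<nu>) x)"
      using packets[OF \<xi>] by blast
    then show ?thesis
      by (rule span_AE_cong[rotated]) (intro span_AE_sum span_AE_scale W_in, simp_all)
  qed
  have translate_in: "translate b (\<phi> (Suc j)) \<in> ?S" if "b \<in> ker (A ^^ Suc j)" for b
    unfolding translate_phi_eq[OF that, abs_def] by (intro span_AE_sum span_AE_scale packet_in)
  show ?case
  proof
    fix f assume "f \<in> V (Suc j)"
    then obtain c where "AE x in M. f x = (\<Sum>a\<in>ker (A ^^ Suc j). c a * translate a (\<phi> (Suc j)) x)"
      using V_expand by blast
    then show "f \<in> ?S"
      by (rule span_AE_cong[rotated]) (intro span_AE_sum span_AE_scale translate_in)
  qed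
qed

text \<open>Within a level this is \<open>W_orthonormal\<close>. Across levels, the wavelets of a lower level and the constant
  function belong to \<open>V j\<close>, to which the wavelets of level \<open>j\<close> are orthogonal.\<close>

lemma wavelet_orthonormal:
  assumes \<psi>: "wavelet_functions M A \<pi> \<phi> \<psi>"
  shows "orthonormal_family M (wavelet_index A) (wavelet_system \<psi>)"
proof -
  have in_V: "translate a (\<psi> \<nu> j) \<in> V (Suc j)"
    and same_level: "\<nu>' \<in> {1..<m} \<Longrightarrow> b \<in> ker (A ^^ j) \<Longrightarrow>
      l2_inner M (translate a (\<psi> \<nu> j)) (translate b (\<psi> \<nu>' j)) = (if \<nu> = \<nu>' \<and> a = b then 1 else 0)"
    and perp: "f \<in> V j \<Longrightarrow> l2_inner M f (translate a (\<psi> \<nu> j)) = 0"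
    if "\<nu> \<in> {1..<m}" "a \<in> ker (A ^^ j)" for \<nu> \<nu>' j a b f
  proof -
    obtain W where W: "W 0 = \<phi> j" "\<And>\<nu>. 0 < \<nu> \<Longrightarrow> W \<nu> = \<psi> \<nu> j"
        "\<And>\<nu>. \<nu> < m \<Longrightarrow> W \<nu> \<in> L2 M"
        "\<And>\<nu> a. \<nu> < m \<Longrightarrow> a \<in> ker (A ^^ j) \<Longrightarrow> translate a (W \<nu>) \<in> V (Suc j)"
        "\<And>\<nu> \<nu>' a b. \<nu> < m \<Longrightarrow> \<nu>' < m \<Longrightarrow> a \<in> ker (A ^^ j) \<Longrightarrow> b \<in> ker (A ^^ j) \<Longrightarrow>
          l2_inner M (translate a (W \<nu>)) (translate b (W \<nu>')) = (if \<nu> = \<nu>' \<and> a = b then 1 else 0)"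
      by (rule wavelet_level[OF \<psi>, of j]) (rule that; assumption)
    have \<nu>: "0 < \<nu>" "\<nu> < m" using that(1) by auto
    show "translate a (\<psi> \<nu> j) \<in> V (Suc j)"
      using W(4)[OF \<nu>(2) that(2)] by (simp add: W(2)[OF \<nu>(1)])
    show "l2_inner M (translate a (\<psi> \<nu> j)) (translate b (\<psi> \<nu>' j)) = (if \<nu> = \<nu>' \<and> a = b then 1 else 0)"
      if *: "\<nu>' \<in> {1..<m}" "b \<in> ker (A ^^ j)"
      using W(5)[OF \<nu>(2) _ \<open>a \<in> ker (A ^^ j)\<close> *(2), of \<nu>'] *(1) by (simp add: W(2) \<nu>(1))
    show "l2_inner M f (translate a (\<psi> \<nu> j)) = 0" if "f \<in> V j"
      using V_perp_W[OF that W(1,3,5) \<nu> \<open>a \<in> ker (A ^^ j)\<close>] by (simp add: W(2)[OF \<nu>(1)])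
  qed
  have one_V: "(\<lambda>_. 1) \<in> V j" for j
  proof -
    have "AE x in M. 1 = \<phi> 0 x"
      using phi_0 by eventually_elim simp
    then have "(\<lambda>_. 1) \<in> V 0"
      by (rule V_AE[OF phi_V, rotated]) (rule L2_bounded[of _ 1], simp_all)
    then show ?thesis using V_mono[of 0 j] by auto
  qed
  have one_perp: "l2_inner M (\<lambda>_. 1) (translate a (\<psi> \<nu> j)) = 0"
    if "\<nu> \<in> {1..<m}" "a \<in> ker (A ^^ j)" for \<nu> j a
    by (rule perp[OF that one_V])
  have less_level: "l2_inner M (translate a (\<psi> \<nu> i)) (translate b (\<psi> \<nu>' j)) = 0"
    if "\<nu> \<in> {1..<m}" "a \<in> ker (A ^^ i)" "\<nu>' \<in> {1..<m}" "b \<in> ker (A ^^ j)" "i < j" for \<nu> \<nu>' i j a b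
    using in_V[OF that(1,2)] V_mono[of "Suc i" j] that(5) by (intro perp[OF that(3,4)]) auto
  have distinct: "l2_inner M (translate a (\<psi> \<nu> i)) (translate b (\<psi> \<nu>' j))
      = (if (\<nu>, i, a) = (\<nu>', j, b) then 1 else 0)"
    if *: "\<nu> \<in> {1..<m}" "a \<in> ker (A ^^ i)" "\<nu>' \<in> {1..<m}" "b \<in> ker (A ^^ j)" for \<nu> \<nu>' i j a b
  proof (cases i j rule: linorder_cases)
    case less
    then show ?thesis using less_level[OF *] by simp
  next
    case equal
    then show ?thesis using same_level[OF *(1,2,3)] *(4) by simp
  next
    case greater
    have "l2_inner M (translate b (\<psi> \<nu>' j)) (translate a (\<psi> \<nu> i)) = 0"
      by (rule less_level[OF *(3,4,1,2) greater])
    with greater show ?thesis by (subst inner_cnj) simp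
  qed
  have one: "l2_inner M (\<lambda>_. 1) (\<lambda>_. 1) = 1"
    using prob_space by (simp add: l2_inner_def)
  show ?thesis
    unfolding orthonormal_family_def
  proof (intro conjI ballI)
    fix i assume "i \<in> wavelet_index A"
    then show "wavelet_system \<psi> i \<in> L2 M"
      using V_L2[OF one_V] V_L2[OF in_V] by (cases i) (auto simp: wavelet_index_def)
  next
    fix i k assume "i \<in> wavelet_index A" "k \<in> wavelet_index A"
    moreover have "l2_inner M (translate a (\<psi> \<nu> j)) (\<lambda>_. 1) = 0"
      if "\<nu> \<in> {1..<m}" "a \<in> ker (A ^^ j)" for \<nu> j a
      by (subst inner_cnj) (simp add: one_perp[OF that])
    ultimately show "l2_inner M (wavelet_system \<psi> i) (wavelet_system \<psi> k) = (if i = k then 1 else 0)"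
      using one one_perp distinct
      by (cases i; cases k) (auto simp: wavelet_index_def simp del: atLeastLessThan_iff split: if_splits)
  qed
qed

theorem wavelet_orthonormal_basis:
  assumes \<psi>: "wavelet_functions M A \<pi> \<phi> \<psi>"
  shows "orthonormal_basis M (wavelet_index A) (wavelet_system \<psi>)"
  unfolding orthonormal_basis_def
proof (intro conjI equalityI)
  let ?I = "wavelet_index A" and ?e = "wavelet_system \<psi>"
  show family: "orthonormal_family M ?I ?e" by (rule wavelet_orthonormal[OF \<psi>])
  show "l2_closure M (fin_span ?I ?e) \<subseteq> L2 M" by (auto simp: l2_closure_def)
  show "L2 M \<subseteq> l2_closure M (fin_span ?I ?e)"
  proof
    fix f assume f: "f \<in> L2 M"
    have "\<exists>s\<in>fin_span ?I ?e. l2_norm M (\<lambda>x. f x - s x) < \<epsilon>" if "\<epsilon> > 0" for \<epsilon>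
    proof -
      obtain g j where g: "g \<in> V j" "l2_norm M (\<lambda>x. f x - g x) < \<epsilon>"
        using f V_dense \<open>\<epsilon> > 0\<close> unfolding l2_closure_def by blast
      with V_subset_wavelet_span[OF \<psi>] obtain s where s: "s \<in> fin_span ?I ?e" "AE x in M. g x = s x"
        by (auto simp: span_AE_def)
      have "s \<in> L2 M"
        using s(1) family by (auto simp: fin_span_def orthonormal_family_def intro!: L2_sum L2_scale)
      note [measurable] = L2_measurable[OF this] L2_measurable[OF f] L2_measurable[OF V_L2[OF g(1)]]
      have "(LINT x|M. (cmod (f x - s x))\<^sup>2) = (LINT x|M. (cmod (f x - g x))\<^sup>2)"
        by (rule integral_cong_AE) (use s(2) in auto)
      with g(2) have "l2_norm M (\<lambda>x. f x - s x) < \<epsilon>" by (simp add: l2_norm_def)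
      with s(1) show ?thesis by blast
    qed
    with f show "f \<in> l2_closure M (fin_span ?I ?e)" by (simp add: l2_closure_def)
  qed
qed

end

theorem mainTheorem4:
  fixes M :: "'a::{topological_ab_group_add, t2_space, second_countable_topology} measure"
    and A :: "'a \<Rightarrow> 'a"
    and V :: "nat \<Rightarrow> ('a \<Rightarrow> complex) set"
    and \<phi> :: "nat \<Rightarrow> 'a \<Rightarrow> complex"
    and \<pi> :: "nat \<Rightarrow> 'a dual_group"
    and \<psi> :: "nat \<Rightarrow> nat \<Rightarrow> 'a \<Rightarrow> complex"
  assumes "compact (UNIV :: 'a set)"
    and "normalized_haar M"
    and "Modules.additive A" and "continuous_on UNIV A" and "surj A"
    and "finite (ker A)"
    and "closure (\<Union>j. ker (A ^^ j)) = UNIV"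
    and "MRA M A V"
    and "orthonormal_scaling_sequence M A V \<phi>"
    and "AE x in M. \<phi> 0 x = 1"
    and "digit_system A \<pi>"
    and "wavelet_functions M A \<pi> \<phi> \<psi>"
  shows "orthonormal_basis M (wavelet_index A) (wavelet_system \<psi>)"
proof -
  interpret normalized_haar M by fact
  interpret additive A by fact
  interpret orthonormal_mra M A \<pi> V \<phi>
  proof unfold_locales
    show "A (x + y) = A x + A y" for x y by (rule add)
    show "closed_l2_subspace M (V j)" "V j \<subseteq> V (Suc j)" "l2_closure M (\<Union>j. V j) = L2 M" for j
      using \<open>MRA M A V\<close> by (auto simp: MRA_def)
  qed fact+
  show ?thesis
    by (rule wavelet_orthonormal_basis) fact
qed

end
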